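(* Let $k\ge1$, $m\ge1$, let $1\le t_1,\dots,t_m\le k$ be distinct integers, $a_1,\dots,a_m$ positive integers, $P=R_{t_1}^{a_1}\cup\cdots\cup R_{t_m}^{a_m}$, and $\alpha_u=\#\{v:1\le v\le m,\ t_v\ge u\}$ for $u\in\mathbb Z_{>0}$. Let $\lambda\in\mathcal P^k$ be nonempty, let $\bar\lambda=(\lambda_1,\dots,\lambda_{l(\lambda)-1})$, $\bar l=l(\lambda)-1$, and suppose $\bar\lambda\subset R_{k+1-\bar l}$. Put $r=\lambda_{l(\lambda)}$ and assume $\max_i t_i<\bar\lambda_{\bar l}$ (with $\bar\lambda_0:=\infty$, so this assumption is vacuous when $l(\lambda)=1$). Then (1) $\displaystyle g^{(k)}_P\,g^{(k)}_\lambda=\sum_{s=0}^{r}(-1)^s\binom{\alpha_{r+1-s}}{s}g^{(k)}_{P\cup\bar\lambda\cup(r-s)}$; (2) $\displaystyle g^{(k)}_{P\cup\lambda}=g^{(k)}_P\sum_{s=0}^{r}\binom{\alpha_r+s-1}{s}g^{(k)}_{\bar\lambda\cup(r-s)}$. In particular, if $\max_i t_i<r$, then $g^{(k)}_{P\cup\lambda}=g^{(k)}_P\,g^{(k)}_\lambda$.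
   Context: Partitions are identified with Young diagrams in French notation (cells $(i,j)$ with $j\le\lambda_i$, row $i$ from the bottom); $l(\lambda)$ is the number of nonzero parts, $\lambda'$ the conjugate; $\lambda\cup\mu$ is the partition whose multiset of parts is the union of those of $\lambda$ and $\mu$; $(s)$ is a one-part partition and $\lambda\cup(0)=\lambda$. $\mathcal P^k$ is the set of partitions with $\lambda_1\le k$. For $1\le t\le k$, $R_t=(t^{k+1-t})$, and $R_t:=\emptyset$ for other integers $t$; $R_t^a$ is the union of $a$ copies of $R_t$. The hook length of $c=(i,j)\in\lambda$ is $\lambda_i+\lambda'_j-i-j+1$. A $(k+1)$-core has no cell of hook length $k+1$; $|\kappa|_{k+1}$ is its number of cells of hook length $<k+1$. The map $\mathfrak p(\kappa)_i=\#\{j:(i,j)\in\kappa,\ \text{hook length}\le k\}$ is a bijection from $(k+1)$-cores to $\mathcal P^k$ with inverse $\mathfrak c$. The residue of $(i,j)$ is $j-i\bmod(k+1)$. For $(k+1)$-cores $\tau\subset\kappa$, $\kappa/\tau$ is a weak $r$-strip if it is a horizontal strip, $|\kappa|_{k+1}=|\tau|_{k+1}+r$, and its cells have exactly $r$ distinct residues. A removable corner of $\mu$ is $(i,j)\in\mu$ with $(i+1,j),(i,j+1)\notin\mu$; $(i,j)$ is $\lambda$-blocked if $(i+1,j)\in\lambda$; $r_{\lambda\mu}$ is the number of distinct residues of non-$\lambda$-blocked removable corners of $\mu$. $h_r$ are the complete homogeneous symmetric functions ($h_0=1$), $\Lambda^{(k)}=\mathbb Z[h_1,\dots,h_k]$.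 $\binom ab=a(a-1)\cdots(a-b+1)/b!$ for $a\in\mathbb Z$, $b\ge0$, and $0$ for $b<0$. The $K$-$k$-Schur functions $\{g^{(k)}_\lambda\}_{\lambda\in\mathcal P^k}$ are the unique elements of $\Lambda^{(k)}$ with $g^{(k)}_\emptyset=1$ and, for $\lambda\in\mathcal P^k$, $0\le r\le k$, $$h_r\,g^{(k)}_\lambda=\sum_{s=0}^{r}(-1)^{r-s}\sum_{\mu\in\mathcal P^k:\ \mathfrak c(\mu)/\mathfrak c(\lambda)\text{ weak }s\text{-strip}}\binom{r_{\mathfrak c(\mu)\mathfrak c(\lambda)}}{r-s}g^{(k)}_\mu .$$ *)

theory Defs
  imports Complex_Main "HOL-Library.Multiset"
begin

section \<open>Formal power series in countably many variables over the integers\<close>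

text \<open>The library has no symmetric functions, so we work in the ambient ring of formal power
  series in variables \<open>x\<^sub>0, x\<^sub>1, \<dots>\<close> with integer coefficients. A monomial is the multiset of the
  indices of its variables, so that multiplying monomials is multiset union and the degree is the
  size.\<close>

typedef mfps = "UNIV :: (nat multiset \<Rightarrow> int) set"
  morphisms mcoeff Abs_mfps ..

setup_lifting type_definition_mfps

definition splits :: "nat multiset \<Rightarrow> (nat multiset \<times> nat multiset) set" where
  "splits m = {(a, b). a + b = m}"

lemma splits_eq_image: "splits m = (\<lambda>a. (a, m - a)) ` {a. a \<subseteq># m}"
  unfolding splits_def by (auto simp: image_iff)

lemma finite_subset_mset: "finite {a. a \<subseteq># (m :: 'a multiset)}"
proof (induction m)
  case empty
  then show ?case by simp
next
  case (add x m)
  have "{a. a \<subseteq># add_mset x m} \<subseteq> {a. a \<subseteq># m} \<union> add_mset x ` {a. a \<subseteq># m}"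
  proof
    fix a assume a: "a \<in> {a. a \<subseteq># add_mset x m}"
    show "a \<in> {a. a \<subseteq># m} \<union> add_mset x ` {a. a \<subseteq># m}"
    proof (cases "x \<in># a")
      case True
      then obtain b where b: "a = add_mset x b" by (metis insert_DiffM)
      with a show ?thesis by auto
    next
      case False
      with a show ?thesis
        by (metis Diff_eq_empty_iff_mset UnCI add_mset_remove_trivial diff_single_trivial
            mem_Collect_eq subset_eq_diff_conv add_mset_add_single)
    qed
  qed
  with add show ?case by (meson finite_UnI finite_imageI finite_subset)
qed

lemma finite_splits [simp]: "finite (splits m)"
  by (simp add: splits_eq_image finite_subset_mset)

lemma splits_assoc:
  fixes f :: "nat multiset \<Rightarrow> nat multiset \<Rightarrow> nat multiset \<Rightarrow> int"
  shows "(\<Sum>(p, c)\<in>splits m. \<Sum>(a, b)\<in>splits p. f a b c) =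
         (\<Sum>(a, q)\<in>splits m. \<Sum>(b, c)\<in>splits q. f a b c)"
proof -
  have "(\<Sum>(p, c)\<in>splits m. \<Sum>(a, b)\<in>splits p. f a b c) =
        (\<Sum>((p, c), (a, b))\<in>(SIGMA z:splits m. splits (fst z)). f a b c)"
    by (subst sum.Sigma [symmetric]) (auto intro!: sum.cong)
  also have "\<dots> = (\<Sum>((a, q), (b, c))\<in>(SIGMA z:splits m. splits (snd z)). f a b c)"
    by (rule sum.reindex_bij_witness
        [where i = "\<lambda>((a, q), (b, c)). ((a + b, c), (a, b))"
           and j = "\<lambda>((p, c), (a, b)). ((a, b + c), (b, c))"])
       (auto simp: splits_def add.assoc)
  also have "\<dots> = (\<Sum>(a, q)\<in>splits m. \<Sum>(b, c)\<in>splits q. f a b c)"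
    by (subst sum.Sigma [symmetric]) (auto intro!: sum.cong)
  finally show ?thesis .
qed

instantiation mfps :: comm_ring_1
begin

lift_definition zero_mfps :: mfps is "\<lambda>_. 0" .
lift_definition one_mfps :: mfps is "\<lambda>m. if m = {#} then 1 else 0" .
lift_definition plus_mfps :: "mfps \<Rightarrow> mfps \<Rightarrow> mfps" is "\<lambda>f g m. f m + g m" .
lift_definition minus_mfps :: "mfps \<Rightarrow> mfps \<Rightarrow> mfps" is "\<lambda>f g m. f m - g m" .
lift_definition uminus_mfps :: "mfps \<Rightarrow> mfps" is "\<lambda>f m. - f m" .
lift_definition times_mfps :: "mfps \<Rightarrow> mfps \<Rightarrow> mfps"
  is "\<lambda>f g m. \<Sum>(a, b)\<in>splits m. f a * g b" .

instance
proof
  fix f g h :: mfps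
  show "f * g * h = f * (g * h)"
  proof (transfer, rule ext)
    fix f g h :: "nat multiset \<Rightarrow> int" and m
    have "(\<Sum>(p, c)\<in>splits m. (\<Sum>(a, b)\<in>splits p. f a * g b) * h c) =
          (\<Sum>(p, c)\<in>splits m. \<Sum>(a, b)\<in>splits p. f a * g b * h c)"
      by (intro sum.cong) (auto simp: sum_distrib_right case_prod_unfold)
    also have "\<dots> = (\<Sum>(a, q)\<in>splits m. \<Sum>(b, c)\<in>splits q. f a * g b * h c)"
      by (rule splits_assoc)
    also have "\<dots> = (\<Sum>(a, q)\<in>splits m. f a * (\<Sum>(b, c)\<in>splits q. g b * h c))"
      by (intro sum.cong) (auto simp: sum_distrib_left mult.assoc case_prod_unfold)
    finally show "(\<Sum>(p, c)\<in>splits m. (\<Sum>(a, b)\<in>splits p. f a * g b) * h c) =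
                  (\<Sum>(a, q)\<in>splits m. f a * (\<Sum>(b, c)\<in>splits q. g b * h c))" .
  qed
  show "f * g = g * f"
  proof (transfer, rule ext)
    fix f g :: "nat multiset \<Rightarrow> int" and m
    show "(\<Sum>(a, b)\<in>splits m. f a * g b) = (\<Sum>(a, b)\<in>splits m. g a * f b)"
      by (rule sum.reindex_bij_witness [where i = prod.swap and j = prod.swap])
         (auto simp: splits_def add.commute)
  qed
  show "1 * f = f"
  proof (transfer, rule ext)
    fix f :: "nat multiset \<Rightarrow> int" and m
    have "(\<Sum>(a, b)\<in>splits m. (if a = {#} then 1 else 0) * f b) =
          (\<Sum>z\<in>{({#} :: nat multiset, m)}. case z of (a, b) \<Rightarrow> (if a = {#} then 1 else 0) * f b)"
      by (rule sum.mono_neutral_right [OF finite_splits]) (auto simp: splits_def split: if_splits)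
    then show "(\<Sum>(a, b)\<in>splits m. (if a = {#} then 1 else 0) * f b) = f m"
      by simp
  qed
  show "(f + g) * h = f * h + g * h"
    by transfer (auto simp: fun_eq_iff sum.distrib [symmetric] distrib_right intro!: sum.cong)
  show "f + g + h = f + (g + h)" by transfer (simp add: add.assoc)
  show "f + g = g + f" by transfer (simp add: add.commute)
  show "0 + f = f" by transfer simp
  show "- f + f = 0" by transfer simp
  show "f - g = f + - g" by transfer simp
  show "(0 :: mfps) \<noteq> 1" by transfer (auto simp: fun_eq_iff)
qed

end

lift_definition hsym :: "nat \<Rightarrow> mfps" is "\<lambda>r m. if size m = r then 1 else 0" .

lemma hsym_0: "hsym 0 = 1"
  by transfer (auto simp: fun_eq_iff)

text \<open>The subring generated by \<open>h\<^sub>1, \<dots>, h\<^sub>k\<close>.\<close>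

inductive_set Lambda :: "nat \<Rightarrow> mfps set" for k :: nat where
  one: "1 \<in> Lambda k"
| gen: "1 \<le> r \<Longrightarrow> r \<le> k \<Longrightarrow> hsym r \<in> Lambda k"
| diff: "f \<in> Lambda k \<Longrightarrow> g \<in> Lambda k \<Longrightarrow> f - g \<in> Lambda k"
| mult: "f \<in> Lambda k \<Longrightarrow> g \<in> Lambda k \<Longrightarrow> f * g \<in> Lambda k"


section \<open>Partitions and Young diagrams\<close>

text \<open>A partition is the weakly decreasing list of its nonzero parts, so \<open>l(\<lambda>)\<close> is the list
  length. Rows and columns are numbered from 1.\<close>

definition is_partition :: "nat list \<Rightarrow> bool" where
  "is_partition la \<longleftrightarrow> sorted_wrt (\<ge>) la \<and> 0 \<notin> set la"

definition part :: "nat list \<Rightarrow> nat \<Rightarrow> nat" where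
  "part la i = (if 1 \<le> i \<and> i \<le> length la then la ! (i - 1) else 0)"

definition diagram :: "nat list \<Rightarrow> (nat \<times> nat) set" where
  "diagram la = {(i, j). 1 \<le> i \<and> 1 \<le> j \<and> j \<le> part la i}"

definition conj_part :: "nat list \<Rightarrow> nat \<Rightarrow> nat" where
  "conj_part la j = card {i. (i, j) \<in> diagram la}"

definition part_union :: "nat list \<Rightarrow> nat list \<Rightarrow> nat list"  (infixl "\<uplus>" 65) where
  "la \<uplus> mu = rev (sort (la @ mu))"

definition one_part :: "nat \<Rightarrow> nat list" where
  "one_part s = (if s = 0 then [] else [s])"

definition bounded_partitions :: "nat \<Rightarrow> nat list set" where
  "bounded_partitions k = {la. is_partition la \<and> part la 1 \<le> k}"

definition rect :: "nat \<Rightarrow> nat \<Rightarrow> nat list" where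
  "rect k t = (if 1 \<le> t \<and> t \<le> k then replicate (k + 1 - t) t else [])"

definition rect_power :: "nat \<Rightarrow> nat \<Rightarrow> nat \<Rightarrow> nat list" where
  "rect_power k t a = ((\<uplus>) (rect k t) ^^ a) []"

definition rect_union :: "nat \<Rightarrow> nat \<Rightarrow> (nat \<Rightarrow> nat) \<Rightarrow> (nat \<Rightarrow> nat) \<Rightarrow> nat list" where
  "rect_union k m t a = foldr (\<uplus>) (map (\<lambda>v. rect_power k (t v) (a v)) [1..<m + 1]) []"


section \<open>Cores and weak strips\<close>

text \<open>All notions below are for \<open>(k + 1)\<close>-cores. The subtractions on \<open>nat\<close> in the hook length
  are exact when \<open>(i, j)\<close> is a cell.\<close>

definition hook :: "nat list \<Rightarrow> nat \<times> nat \<Rightarrow> nat" where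
  "hook la = (\<lambda>(i, j). part la i + conj_part la j + 1 - i - j)"

definition is_core :: "nat \<Rightarrow> nat list \<Rightarrow> bool" where
  "is_core k ka \<longleftrightarrow> is_partition ka \<and> (\<forall>c\<in>diagram ka. hook ka c \<noteq> k + 1)"

definition core_size :: "nat \<Rightarrow> nat list \<Rightarrow> nat" where
  "core_size k ka = card {c \<in> diagram ka. hook ka c < k + 1}"

text \<open>No zeros occur in the following list if \<open>ka\<close> is a core: the last cell of a row has hook
  length at most \<open>k\<close>, since otherwise its column would contain a cell of hook length \<open>k + 1\<close>.\<close>

definition core_to_bounded :: "nat \<Rightarrow> nat list \<Rightarrow> nat list" where
  "core_to_bounded k ka =
     map (\<lambda>i. card {j. (i, j) \<in> diagram ka \<and> hook ka (i, j) \<le> k}) [1..<length ka + 1]"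

definition bounded_to_core :: "nat \<Rightarrow> nat list \<Rightarrow> nat list" where
  "bounded_to_core k = the_inv_into {ka. is_core k ka} (core_to_bounded k)"

definition residue :: "nat \<Rightarrow> nat \<times> nat \<Rightarrow> int" where
  "residue k = (\<lambda>(i, j). (int j - int i) mod (int k + 1))"

definition horizontal_strip :: "nat list \<Rightarrow> nat list \<Rightarrow> bool" where
  "horizontal_strip ka ta \<longleftrightarrow>
     diagram ta \<subseteq> diagram ka \<and> inj_on snd (diagram ka - diagram ta)"

definition weak_strip :: "nat \<Rightarrow> nat \<Rightarrow> nat list \<Rightarrow> nat list \<Rightarrow> bool" where
  "weak_strip k r ka ta \<longleftrightarrow>
     horizontal_strip ka ta \<and> core_size k ka = core_size k ta + r \<and>
     card (residue k ` (diagram ka - diagram ta)) = r"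

definition removable_corner :: "nat list \<Rightarrow> nat \<times> nat \<Rightarrow> bool" where
  "removable_corner mu = (\<lambda>(i, j).
     (i, j) \<in> diagram mu \<and> (i + 1, j) \<notin> diagram mu \<and> (i, j + 1) \<notin> diagram mu)"

definition blocked :: "nat list \<Rightarrow> nat \<times> nat \<Rightarrow> bool" where
  "blocked la = (\<lambda>(i, j). (i + 1, j) \<in> diagram la)"

definition r_number :: "nat \<Rightarrow> nat list \<Rightarrow> nat list \<Rightarrow> nat" where
  "r_number k la mu = card (residue k ` {c. removable_corner mu c \<and> \<not> blocked la c})"


section \<open>Binomial coefficients with an integer upper argument\<close>

text \<open>The library restricts the type of \<open>gchoose\<close> to fields of characteristic 0, so the
  integer-valued version is spelled out. The division is exact.\<close>

definition ibinom :: "int \<Rightarrow> nat \<Rightarrow> int" where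
  "ibinom a b = (\<Prod>i=0..<b. a - int i) div fact b"

lemma of_int_ibinom: "real_of_int (ibinom a b) = real_of_int a gchoose b"
  by (simp only: ibinom_def gbinomial_prod_rev [where 'a = int, symmetric] of_int_gbinomial)


section \<open>\<open>K\<close>-\<open>k\<close>-Schur functions\<close>

text \<open>The family indexed by the partitions in \<open>bounded_partitions k\<close> is determined by this
  predicate; the values at other lists are irrelevant.\<close>

definition K_k_Schur :: "nat \<Rightarrow> (nat list \<Rightarrow> mfps) \<Rightarrow> bool" where
  "K_k_Schur k g \<longleftrightarrow>
     (\<forall>la\<in>bounded_partitions k. g la \<in> Lambda k) \<and>
     g [] = 1 \<and>
     (\<forall>la\<in>bounded_partitions k. \<forall>r\<le>k.
        hsym r * g la =
          (\<Sum>s=0..r. (- 1) ^ (r - s) *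
             (\<Sum>mu\<in>{mu \<in> bounded_partitions k.
                      weak_strip k s (bounded_to_core k mu) (bounded_to_core k la)}.
                of_int (ibinom (int (r_number k (bounded_to_core k mu) (bounded_to_core k la)))
                                (r - s)) * g mu)))"

definition alpha :: "nat \<Rightarrow> (nat \<Rightarrow> nat) \<Rightarrow> nat \<Rightarrow> nat" where
  "alpha m t u = card {v. 1 \<le> v \<and> v \<le> m \<and> t v \<ge> u}"

end

theory Submission
  imports Defs "HOL-Computational_Algebra.Formal_Power_Series"
begin

text \<open>Raising a cell by the k + 1 - t rows of the rectangle R_t changes its residue by t, and
  t is also the difference between the bottom row of that rectangle in the core and the row where
  the next one starts. So the cells added at the bottoms of all rectangles repeat the same residues,
  and the corners at the tops of equal rectangles share one residue. This is why only the set of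
  widths enters the coefficients, and the multiplicities do not. Counted from the first cell added
  to the lowest row inside P, the residues in the rows of \<nu> are the shifted parts v + l - i. The
  bound on the main hook keeps them between 0 and k, so that counting residues becomes counting
  integers. The bound of r by the last part of \<nu> is used twice. It rules out strips whose bottom
  row grows so far that its bounded part violates the hook bound. It also keeps the number of open
  corners constant in u, except at the largest u, where the coefficient is 1 anyway; this is the
  shape that the Vandermonde identity needs.\<close>

text \<open>
  Reading rows from the top, the core \<open>\<kappa>\<close> of a bounded partition \<open>\<lambda>\<close> is determined by the recursion
  that row \<open>i\<close> of \<open>\<kappa>\<close> is \<open>\<lambda>\<^sub>i\<close> plus row \<open>i + k + 1 - \<lambda>\<^sub>i\<close> of \<open>\<kappa>\<close>. For a union \<open>P\<close> of rectangles below
  which a partition \<open>\<nu>\<close> with wider rows and small main hook is placed, this makes the core explicit.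
  A horizontal strip that adds \<open>u\<close> cells to the lowest row inside \<open>P\<close> uses at least \<open>u\<close> residues there
  but gains size at most \<open>u\<close>, with equality only if it amounts to inserting the part \<open>u\<close> into \<open>P\<close>.
  So the weak strips of size at most the last part of \<open>\<nu>\<close> consist of a horizontal strip on the rows
  of \<open>\<nu>\<close> and one further part \<open>u\<close>, independently of \<open>P\<close>.

  Hence multiplication by \<open>h\<^sub>r\<close> over \<open>P \<union> \<nu>\<close> and over \<open>\<nu>\<close> has the same terms, and the binomial
  coefficients differ only in that the numbers of open corners differ by \<open>\<alpha>\<^bsub>u+1\<^esub>\<close>. By induction on
  the number of rows and on \<open>r\<close>, with the Vandermonde identity, this gives the first formula; the
  second one is its inversion.
\<close>

section \<open>Partitions and the core of a bounded partition\<close>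

lemma part_Nil [simp]: "part [] i = 0"
  by (simp add: part_def)

lemma part_0 [simp]: "part xs 0 = 0"
  by (simp add: part_def)

lemma part_Cons_Suc [simp]: "part (x # xs) (Suc i) = (if i = 0 then x else part xs i)"
  by (cases i) (auto simp: part_def)

lemma part_Suc: "i < length xs \<Longrightarrow> part xs (Suc i) = xs ! i"
  by (simp add: part_def)

lemma part_eq_0: "length xs < i \<Longrightarrow> part xs i = 0"
  by (simp add: part_def)

lemma part_append:
  "part (xs @ ys) i = (if i \<le> length xs then part xs i else part ys (i - length xs))"
  by (auto simp: part_def nth_append diff_commute)

lemma part_replicate: "part (replicate m c) i = (if 1 \<le> i \<and> i \<le> m then c else 0)"
  by (auto simp: part_def)

lemma part_in_set: "1 \<le> i \<Longrightarrow> i \<le> length xs \<Longrightarrow> part xs i \<in> set xs"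
  by (simp add: part_def)

lemma part_le: "(\<And>x. x \<in> set xs \<Longrightarrow> x \<le> c) \<Longrightarrow> part xs i \<le> c"
  by (auto simp: part_def)

lemma sum_list_part: "sum_list xs = (\<Sum>i\<in>{1..length xs}. part xs i)"
proof -
  have "sum_list xs = (\<Sum>i\<in>{0..<length xs}. xs ! i)"
    by (simp add: sum_list_sum_nth)
  also have "\<dots> = (\<Sum>i\<in>{1..length xs}. part xs i)"
    by (rule sum.reindex_bij_witness [where i = "\<lambda>i. i - 1" and j = Suc]) (auto simp: part_Suc)
  finally show ?thesis .
qed

lemma is_partition_Nil [simp]: "is_partition []"
  by (simp add: is_partition_def)

lemma is_partition_Cons:
  "is_partition (x # xs) \<longleftrightarrow> 0 < x \<and> (\<forall>y\<in>set xs. y \<le> x) \<and> is_partition xs"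
  by (auto simp: is_partition_def)

lemma part_mono:
  assumes "is_partition xs" "1 \<le> i" "i \<le> j"
  shows "part xs j \<le> part xs i"
proof (cases "j \<le> length xs \<and> i < j")
  case True
  then have "xs ! (i - 1) \<ge> xs ! (j - 1)"
    using assms by (auto simp: is_partition_def intro!: sorted_wrt_nth_less [where P = "(\<ge>)"])
  then show ?thesis using True assms by (simp add: part_def)
qed (use assms in \<open>auto simp: part_def\<close>)

lemma part_pos:
  assumes "is_partition xs" "1 \<le> i" "i \<le> length xs"
  shows "0 < part xs i"
  using assms part_in_set [of i xs] by (metis gr0I is_partition_def)

lemma is_partition_part_iff:
  "is_partition xs \<longleftrightarrow> (\<forall>i. 1 \<le> i \<longrightarrow> part xs (Suc i) \<le> part xs i) \<and> 0 \<notin> set xs"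
proof
  assume "is_partition xs"
  then show "(\<forall>i. 1 \<le> i \<longrightarrow> part xs (Suc i) \<le> part xs i) \<and> 0 \<notin> set xs"
    using part_mono [of xs] by (auto simp: is_partition_def)
next
  assume *: "(\<forall>i. 1 \<le> i \<longrightarrow> part xs (Suc i) \<le> part xs i) \<and> 0 \<notin> set xs"
  have "xs ! i \<ge> xs ! Suc i" if "Suc i < length xs" for i
    using * that part_Suc [of i xs] part_Suc [of "Suc i" xs] by (metis Suc_lessD le_add1 plus_1_eq_Suc)
  then have "sorted_wrt (\<ge>) xs"
    by (simp add: sorted_wrt_iff_nth_Suc_transp transp_def)
  then show "is_partition xs" using * by (simp add: is_partition_def)
qed

lemma is_partition_Cons_part:
  "is_partition (x # xs) \<longleftrightarrow> 0 < x \<and> part xs 1 \<le> x \<and> is_partition xs"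
proof
  assume "is_partition (x # xs)"
  then show "0 < x \<and> part xs 1 \<le> x \<and> is_partition xs"
    using part_mono [of "x # xs" 1 2] by (auto simp: is_partition_Cons numeral_2_eq_2)
next
  assume *: "0 < x \<and> part xs 1 \<le> x \<and> is_partition xs"
  have "y \<le> x" if "y \<in> set xs" for y
  proof -
    from that obtain i where "i < length xs" "y = part xs (Suc i)"
      by (metis in_set_conv_nth part_Suc)
    then show ?thesis using * part_mono [of xs 1 "Suc i"] by simp
  qed
  with * show "is_partition (x # xs)" by (simp add: is_partition_Cons)
qed

lemma partition_eqI:
  assumes "is_partition xs" "is_partition ys" "\<And>i. 1 \<le> i \<Longrightarrow> part xs i = part ys i"
  shows "xs = ys"
proof (rule nth_equalityI)
  have len: "i \<le> length xs \<longleftrightarrow> i \<le> length ys" if "1 \<le> i" for i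
    using that assms part_pos [of xs i] part_pos [of ys i] by (metis linorder_not_less part_eq_0 less_irrefl)
  show "length xs = length ys"
    using len [of "length xs"] len [of "length ys"]
    by (metis One_nat_def Suc_leI le0 le_antisym le_refl not_gr_zero)
  show "xs ! i = ys ! i" if "i < length xs" for i
    using that assms(3) [of "Suc i"] \<open>length xs = length ys\<close> by (simp add: part_Suc)
qed

section \<open>Diagrams, conjugates and hooks when a bottom row is added\<close>

lemma mem_diagram: "(i, j) \<in> diagram la \<longleftrightarrow> 1 \<le> i \<and> 1 \<le> j \<and> j \<le> part la i"
  by (simp add: diagram_def)

lemma diagram_row_le: "(i, j) \<in> diagram la \<Longrightarrow> i \<le> length la"
  by (metis mem_diagram le_zero_eq linorder_not_less not_one_le_zero part_eq_0)

lemma finite_diagram [simp]: "finite (diagram la)"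
proof (rule finite_subset)
  show "diagram la \<subseteq> (SIGMA i:{1..length la}. {1..part la i})"
    using diagram_row_le by (auto simp: mem_diagram)
qed simp

lemma le_conj_part_iff:
  assumes "is_partition la" "1 \<le> i" "1 \<le> j"
  shows "i \<le> conj_part la j \<longleftrightarrow> j \<le> part la i"
proof -
  let ?S = "{i. (i, j) \<in> diagram la}"
  have S: "?S = {1..card ?S}"
  proof -
    have fin: "finite ?S"
      by (rule finite_subset [of _ "{1..length la}"]) (use diagram_row_le in \<open>fastforce simp: mem_diagram\<close>)+
    show ?thesis
    proof (cases "?S = {}")
      case False
      define M where "M = Max ?S"
      have "M \<in> ?S" using Max_in [OF fin False] by (simp add: M_def)
      have "?S = {1..M}"
      proof (intro equalityI subsetI)
        fix x assume "x \<in> ?S"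
        then show "x \<in> {1..M}" using Max_ge [OF fin] by (auto simp: M_def mem_diagram)
      next
        fix x assume "x \<in> {1..M}"
        then show "x \<in> ?S"
          using \<open>M \<in> ?S\<close> part_mono [OF assms(1), of x M] by (auto simp: mem_diagram)
      qed
      then show ?thesis by simp
    qed simp
  qed
  have "i \<le> conj_part la j \<longleftrightarrow> i \<in> {1..card ?S}"
    using assms by (simp add: conj_part_def)
  also have "\<dots> \<longleftrightarrow> j \<le> part la i"
    using S assms by (metis (mono_tags, lifting) mem_Collect_eq mem_diagram)
  finally show ?thesis .
qed

lemma conj_part_Cons:
  assumes "1 \<le> j" "j \<le> x"
  shows "conj_part (x # ka) j = Suc (conj_part ka j)"
proof -
  have "{i. (i, j) \<in> diagram (x # ka)} = insert 1 (Suc ` {i. (i, j) \<in> diagram ka})"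
    (is "?A = ?B")
  proof (intro equalityI subsetI)
    fix i assume "i \<in> ?A"
    then show "i \<in> ?B" using assms by (cases i) (auto simp: mem_diagram split: if_splits)
  qed (use assms in \<open>auto simp: mem_diagram\<close>)
  moreover have "finite {i. (i, j) \<in> diagram ka}"
    by (rule finite_subset [of _ "{1..length ka}"]) (use diagram_row_le in \<open>fastforce simp: mem_diagram\<close>)+
  moreover have "1 \<notin> Suc ` {i. (i, j) \<in> diagram ka}" by (auto simp: mem_diagram)
  ultimately show ?thesis by (simp add: conj_part_def card_image)
qed

lemma hook_Cons_1:
  assumes "1 \<le> j" "j \<le> x"
  shows "hook (x # ka) (1, j) = x - j + conj_part ka j + 1"
  using assms by (simp add: hook_def conj_part_Cons)

text \<open>A hook extends to the right and upwards, so a new bottom row, which is a new head of the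
  list, does not affect the cells above it. This is what makes recursion on the list possible for
  cores and for their bounded partitions.\<close>

lemma hook_Cons_Suc:
  assumes "is_partition (x # ka)" "(i, j) \<in> diagram ka"
  shows "hook (x # ka) (Suc i, j) = hook ka (i, j)"
proof -
  have "part ka i \<le> part ka 1" using assms by (auto simp: mem_diagram is_partition_Cons intro: part_mono)
  then have "j \<le> x" using assms by (auto simp: mem_diagram is_partition_Cons_part)
  with assms show ?thesis by (auto simp: hook_def mem_diagram conj_part_Cons)
qed

lemma core_to_bounded_Cons:
  assumes "is_partition (x # ka)"
  shows "core_to_bounded k (x # ka) =
    card {j \<in> {1..x}. hook (x # ka) (1, j) \<le> k} # core_to_bounded k ka"
proof -
  have "[1..<length (x # ka) + 1] = 1 # map Suc [1..<length ka + 1]"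
    by (simp add: upt_conv_Cons map_Suc_upt del: upt_Suc)
  moreover have "{j. (Suc i, j) \<in> diagram (x # ka) \<and> hook (x # ka) (Suc i, j) \<le> k} =
      {j. (i, j) \<in> diagram ka \<and> hook ka (i, j) \<le> k}" if "1 \<le> i" for i
    using that hook_Cons_Suc [OF assms] by (auto simp: mem_diagram)
  moreover have "{j. (1, j) \<in> diagram (x # ka) \<and> hook (x # ka) (1, j) \<le> k} =
      {j \<in> {1..x}. hook (x # ka) (1, j) \<le> k}"
    by (auto simp: mem_diagram)
  ultimately show ?thesis
    by (simp add: core_to_bounded_def o_def del: upt_Suc)
qed

lemma is_core_Cons:
  assumes "is_partition (x # ka)"
  shows "is_core k (x # ka) \<longleftrightarrow>
    is_core k ka \<and> (\<forall>j\<in>{1..x}. hook (x # ka) (1, j) \<noteq> k + 1)"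
proof -
  have "(\<forall>c\<in>diagram (x # ka). hook (x # ka) c \<noteq> k + 1) \<longleftrightarrow>
      (\<forall>c\<in>diagram ka. hook ka c \<noteq> k + 1) \<and> (\<forall>j\<in>{1..x}. hook (x # ka) (1, j) \<noteq> k + 1)"
    (is "?L \<longleftrightarrow> ?R")
  proof
    assume L: ?L
    have "hook ka (i, j) \<noteq> k + 1" if "(i, j) \<in> diagram ka" for i j
      using hook_Cons_Suc [OF assms that] bspec [OF L, of "(Suc i, j)"] that
      by (auto simp: mem_diagram)
    moreover have "hook (x # ka) (1, j) \<noteq> k + 1" if "j \<in> {1..x}" for j
      using bspec [OF L, of "(1, j)"] that by (auto simp: mem_diagram)
    ultimately show ?R by auto
  next
    assume R: ?R
    have "hook (x # ka) (i, j) \<noteq> k + 1" if c: "(i, j) \<in> diagram (x # ka)" for i j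
    proof (cases "i = 1")
      case True
      with c R show ?thesis by (auto simp: mem_diagram)
    next
      case False
      then obtain i' where i: "i = Suc i'" "1 \<le> i'"
        using c by (cases i) (auto simp: mem_diagram)
      with c have "(i', j) \<in> diagram ka" by (auto simp: mem_diagram)
      with R i show ?thesis using hook_Cons_Suc [OF assms, of i' j] by auto
    qed
    then show ?L by auto
  qed
  then show ?thesis using assms by (auto simp: is_core_def is_partition_Cons)
qed

section \<open>The core as a recursion on rows\<close>

fun core_of :: "nat \<Rightarrow> nat list \<Rightarrow> nat list" where
  "core_of k [] = []"
| "core_of k (m # ms) = (m + part (core_of k ms) (Suc k - m)) # core_of k ms"

lemma length_core_of [simp]: "length (core_of k ms) = length ms"
  by (induction ms) auto

text \<open>Hook lengths decrease along the row, so the cells of hook length at most k are its last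
  m cells. The cell before them has hook length above k + 1, hence at least k + 1 - m cells above
  it, while the first of the m cells has at most k - m. So row k + 1 - m of \<open>ka\<close> ends
  exactly at column x - m.\<close>

lemma core_row_imp:
  assumes p: "is_partition (x # ka)"
    and h: "\<forall>j\<in>{1..x}. hook (x # ka) (1, j) \<noteq> k + 1"
    and m: "m = card {j \<in> {1..x}. hook (x # ka) (1, j) \<le> k}"
  shows "x = m + part ka (Suc k - m)"
proof -
  have pk: "is_partition ka" using p by (simp add: is_partition_Cons)
  let ?J = "{j \<in> {1..x}. hook (x # ka) (1, j) \<le> k}"
  have conj_mono: "conj_part ka j' \<le> conj_part ka j" if "1 \<le> j" "j \<le> j'" for j j'
  proof (cases "conj_part ka j' = 0")
    case False
    then show ?thesis
      using that le_conj_part_iff [OF pk, of "conj_part ka j'" j'] le_conj_part_iff [OF pk, of "conj_part ka j'" j]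
      by simp
  qed simp
  have up: "j' \<in> ?J" if "j \<in> ?J" "j \<le> j'" "j' \<le> x" for j j'
    using that conj_mono [of j j'] by (auto simp: hook_Cons_1 simp del: One_nat_def)
  have fin: "finite ?J" by simp
  have J: "?J = {x - m<..x}"
  proof (cases "?J = {}")
    case True
    then have "m = 0" unfolding m by (simp only: True card.empty)
    then show ?thesis using True by simp
  next
    case False
    define a where "a = Min ?J"
    have "a \<in> ?J" using Min_in [OF fin False] by (simp add: a_def)
    have "?J = {a..x}"
    proof (intro equalityI subsetI)
      fix y assume "y \<in> ?J"
      then show "y \<in> {a..x}" using Min_le [OF fin] by (auto simp: a_def)
    next
      fix y assume "y \<in> {a..x}"
      then show "y \<in> ?J" using up [OF \<open>a \<in> ?J\<close>, of y] by simp
    qed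
    have "m = Suc x - a" unfolding m \<open>?J = {a..x}\<close> by simp
    moreover have "1 \<le> a" "a \<le> x" using \<open>a \<in> ?J\<close> by auto
    ultimately have "Suc (x - m) = a" by linarith
    then show ?thesis unfolding \<open>?J = {a..x}\<close> by (metis atLeastSucAtMost_greaterThanAtMost)
  qed
  have "card ?J \<le> card {1..x}" by (rule card_mono) auto
  then have "m \<le> x" by (simp add: m)
  have le: "x - m \<le> part ka (Suc k - m)" if "m \<le> k"
  proof (cases "x - m = 0")
    case False
    then have "x - m \<in> {1..x}" "x - m \<notin> ?J" using J by auto
    then have "hook (x # ka) (1, x - m) > k + 1" using h
      by (metis (mono_tags, lifting) One_nat_def Suc_eq_plus1 le_SucE linorder_not_less mem_Collect_eq)
    then have "Suc k - m \<le> conj_part ka (x - m)"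
      using False \<open>m \<le> x\<close> by (subst (asm) hook_Cons_1) auto
    then show ?thesis using le_conj_part_iff [OF pk, of "Suc k - m" "x - m"] that False by simp
  qed simp
  have ge: "m \<le> k \<and> part ka (Suc k - m) \<le> x - m"
  proof (cases "m = 0")
    case True
    have "part ka (Suc k) \<le> part ka 1" using pk by (rule part_mono) auto
    then show ?thesis using True p by (simp add: is_partition_Cons_part)
  next
    case False
    then have "Suc (x - m) \<in> ?J" using J \<open>m \<le> x\<close> by auto
    then have "hook (x # ka) (1, Suc (x - m)) \<le> k" by simp
    then have *: "m + conj_part ka (Suc (x - m)) \<le> k"
      using False \<open>m \<le> x\<close> by (subst (asm) hook_Cons_1) auto
    then have "\<not> Suc k - m \<le> conj_part ka (Suc (x - m))" by simp
    then show ?thesis using le_conj_part_iff [OF pk, of "Suc k - m" "Suc (x - m)"] * by auto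
  qed
  from ge le \<open>m \<le> x\<close> show ?thesis by simp
qed

text \<open>Columns up to the end of row k + 1 - m of \<open>ka\<close> have at least m cells to the
  right and k + 1 - m above, so the hook length is at least k + 2. Later columns have at most m - 1
  and k - m, so it is at most k. The value k + 1 is jumped over.\<close>

lemma core_row:
  assumes p: "is_partition (x # ka)" and x: "x = m + part ka (Suc k - m)" and "1 \<le> m" "m \<le> k"
  shows "\<forall>j\<in>{1..x}. hook (x # ka) (1, j) \<noteq> k + 1"
    and "card {j \<in> {1..x}. hook (x # ka) (1, j) \<le> k} = m"
proof -
  have pk: "is_partition ka" using p by (simp add: is_partition_Cons)
  define q where "q = part ka (Suc k - m)"
  have big: "hook (x # ka) (1, j) > k + 1" if "1 \<le> j" "j \<le> q" for j
  proof -
    have "Suc k - m \<le> conj_part ka j"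
      using that le_conj_part_iff [OF pk, of "Suc k - m" j] assms by (simp add: q_def)
    then show ?thesis using that x assms by (subst hook_Cons_1) (auto simp: q_def)
  qed
  have small: "hook (x # ka) (1, j) \<le> k" if "q < j" "j \<le> x" for j
  proof -
    have "\<not> Suc k - m \<le> conj_part ka j"
      using that le_conj_part_iff [OF pk, of "Suc k - m" j] assms by (simp add: q_def)
    then show ?thesis using that x assms by (subst hook_Cons_1) (auto simp: q_def)
  qed
  show "\<forall>j\<in>{1..x}. hook (x # ka) (1, j) \<noteq> k + 1"
  proof
    fix j assume "j \<in> {1..x}"
    then show "hook (x # ka) (1, j) \<noteq> k + 1" using big [of j] small [of j] by (cases "j \<le> q") auto
  qed
  have "{j \<in> {1..x}. hook (x # ka) (1, j) \<le> k} = {q<..x}"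
  proof (intro equalityI subsetI)
    fix j assume "j \<in> {j \<in> {1..x}. hook (x # ka) (1, j) \<le> k}"
    then show "j \<in> {q<..x}" using big [of j] by (cases "j \<le> q") auto
  qed (use small in auto)
  then show "card {j \<in> {1..x}. hook (x # ka) (1, j) \<le> k} = m"
    using x by (simp add: q_def)
qed

lemma bounded_partitions_Cons:
  "m # ms \<in> bounded_partitions k \<longleftrightarrow>
     1 \<le> m \<and> m \<le> k \<and> part ms 1 \<le> m \<and> ms \<in> bounded_partitions k"
  by (auto simp: bounded_partitions_def is_partition_Cons_part)

text \<open>The bottom part m is at least the part above it, so it reads a lower, hence no shorter,
  row of the core than that part does.\<close>

lemma is_partition_core_of:
  "ms \<in> bounded_partitions k \<Longrightarrow> is_partition (core_of k ms)"
proof (induction ms)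
  case (Cons m ms)
  then have IH: "is_partition (core_of k ms)" and m: "1 \<le> m" "m \<le> k" "part ms 1 \<le> m"
    by (auto simp: bounded_partitions_Cons)
  have "part (core_of k ms) 1 \<le> m + part (core_of k ms) (Suc k - m)"
  proof (cases ms)
    case (Cons m' ms')
    have "part (core_of k ms') (Suc k - m') = part (core_of k ms) (Suc (Suc k - m'))"
      using m Cons by auto
    also have "\<dots> \<le> part (core_of k ms) (Suc k - m)"
      using m Cons by (intro part_mono IH) auto
    finally show ?thesis using m Cons by simp
  qed simp
  then show ?case using IH m by (simp add: is_partition_Cons_part)
qed simp

lemma core_of_core:
  "ms \<in> bounded_partitions k \<Longrightarrow> is_core k (core_of k ms) \<and> core_to_bounded k (core_of k ms) = ms"
proof (induction ms)
  case Nil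
  then show ?case by (auto simp: is_core_def mem_diagram core_to_bounded_def)
next
  case (Cons m ms)
  have p: "is_partition (core_of k (m # ms))" using Cons.prems by (rule is_partition_core_of)
  have m: "1 \<le> m" "m \<le> k" using Cons.prems by (auto simp: bounded_partitions_Cons)
  note p' = p [simplified core_of.simps]
  show ?case
    using Cons.IH Cons.prems core_row [OF p' refl m]
    by (simp add: is_core_Cons [OF p'] core_to_bounded_Cons [OF p'] bounded_partitions_Cons)
qed

text \<open>Gives the injectivity on cores without which \<open>the_inv_into\<close> in
  \<open>bounded_to_core\<close> could not be evaluated.\<close>

lemma core_eq_core_of:
  "is_core k ka \<Longrightarrow> ka = core_of k (core_to_bounded k ka)"
proof (induction ka)
  case Nil
  then show ?case by (simp add: core_to_bounded_def)
next
  case (Cons x ka)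
  have p: "is_partition (x # ka)" using Cons.prems by (simp add: is_core_def)
  show ?case
    using Cons core_row_imp [OF p _ refl, of k]
    by (simp add: core_to_bounded_Cons [OF p] is_core_Cons [OF p])
qed

lemma bounded_to_core_eq:
  assumes "ms \<in> bounded_partitions k"
  shows "bounded_to_core k ms = core_of k ms"
  unfolding bounded_to_core_def
proof (rule the_inv_into_f_eq)
  show "inj_on (core_to_bounded k) {ka. is_core k ka}"
    by (rule inj_onI) (metis core_eq_core_of mem_Collect_eq)
qed (use core_of_core [OF assms] in auto)

lemma core_size_eq_sum_list: "core_size k ka = sum_list (core_to_bounded k ka)"
proof -
  let ?R = "\<lambda>i. {j. (i, j) \<in> diagram ka \<and> hook ka (i, j) \<le> k}"
  have "{c \<in> diagram ka. hook ka c < k + 1} = (SIGMA i:{1..length ka}. ?R i)"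
    using diagram_row_le by (auto simp: mem_diagram)
  moreover have "finite (?R i)" for i
    by (rule finite_subset [of _ "{1..part ka i}"]) (auto simp: mem_diagram)
  ultimately have "core_size k ka = (\<Sum>i\<in>{1..length ka}. card (?R i))"
    by (simp add: core_size_def)
  also have "\<dots> = (\<Sum>i\<leftarrow>[1..<length ka + 1]. card (?R i))"
    by (simp add: interv_sum_list_conv_sum_set_nat atLeastLessThanSuc_atLeastAtMost del: upt_Suc)
  finally show ?thesis by (simp add: core_to_bounded_def)
qed

lemma core_size_core_of: "ms \<in> bounded_partitions k \<Longrightarrow> core_size k (core_of k ms) = sum_list ms"
  by (simp add: core_size_eq_sum_list core_of_core)

section \<open>Horizontal strips, weak strips and open corners in terms of row lengths\<close>

definition interlaced :: "nat list \<Rightarrow> nat list \<Rightarrow> bool" where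
  "interlaced ka ta \<longleftrightarrow> (\<forall>i\<ge>1. part ta i \<le> part ka i \<and> part ka (Suc i) \<le> part ta i)"

lemma horizontal_strip_iff:
  assumes ka: "is_partition ka" and ta: "is_partition ta"
  shows "horizontal_strip ka ta \<longleftrightarrow> interlaced ka ta"
proof
  assume h: "horizontal_strip ka ta"
  show "interlaced ka ta"
    unfolding interlaced_def
  proof (intro allI impI conjI)
    fix i :: nat assume i: "1 \<le> i"
    show le: "part ta i \<le> part ka i"
    proof (cases "part ta i = 0")
      case False
      then have "(i, part ta i) \<in> diagram ta" using i by (simp add: mem_diagram)
      then have "(i, part ta i) \<in> diagram ka" using h by (auto simp: horizontal_strip_def)
      then show ?thesis by (simp add: mem_diagram)
    qed simp
    show "part ka (Suc i) \<le> part ta i"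
    proof (rule ccontr)
      define j where "j = part ka (Suc i)"
      assume "\<not> ?thesis"
      then have "part ta i < j" by (simp add: j_def)
      moreover have "part ta (Suc i) \<le> part ta i" "j \<le> part ka i"
        using i ka ta by (auto simp: j_def intro: part_mono)
      ultimately have "(i, j) \<in> diagram ka - diagram ta" "(Suc i, j) \<in> diagram ka - diagram ta"
        using i by (auto simp: mem_diagram j_def)
      then have "(i, j) = (Suc i, j)"
        using h unfolding horizontal_strip_def by (metis inj_onD snd_conv)
      then show False by simp
    qed
  qed
next
  assume h: "interlaced ka ta"
  have "diagram ta \<subseteq> diagram ka"
    using h by (auto simp: interlaced_def mem_diagram intro: order_trans)
  moreover have "i = i'" if "(i, j) \<in> diagram ka - diagram ta" "(i', j) \<in> diagram ka - diagram ta" for i i' j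
  proof -
    have "\<not> i < i'" if "(i, j) \<in> diagram ka - diagram ta" "(i', j) \<in> diagram ka - diagram ta" for i i'
    proof
      assume "i < i'"
      then have "part ka i' \<le> part ka (Suc i)" using ka by (intro part_mono) auto
      also have "\<dots> \<le> part ta i" using h that by (auto simp: interlaced_def mem_diagram)
      finally show False using that by (auto simp: mem_diagram)
    qed
    with that show ?thesis by (metis linorder_neqE_nat)
  qed
  then have "inj_on snd (diagram ka - diagram ta)"
    by (intro inj_onI) (metis prod.collapse)
  ultimately show "horizontal_strip ka ta" by (simp add: horizontal_strip_def)
qed

lemma weak_strip_core_of_iff:
  assumes "mu \<in> bounded_partitions k" "la \<in> bounded_partitions k"
  shows "weak_strip k s (bounded_to_core k mu) (bounded_to_core k la) \<longleftrightarrow>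
    interlaced (core_of k mu) (core_of k la) \<and> sum_list mu = sum_list la + s \<and>
    card (residue k ` (diagram (core_of k mu) - diagram (core_of k la))) = s"
  using assms
  by (simp add: weak_strip_def bounded_to_core_eq core_size_core_of is_partition_core_of
      horizontal_strip_iff)

text \<open>If row i + 1 of \<open>ka\<close> is shorter than row i of \<open>ta\<close>, then so is
  row i + 1 of \<open>ta\<close>, which it contains. Thus being unblocked already makes the last
  cell of the row a corner.\<close>

lemma r_number_eq:
  assumes "is_partition ta" "interlaced ka ta"
  shows "r_number k ka ta =
    card (residue k ` {(i, part ta i) |i. 1 \<le> i \<and> part ka (Suc i) < part ta i})"
proof -
  have "{c. removable_corner ta c \<and> \<not> blocked ka c} =
      {(i, part ta i) |i. 1 \<le> i \<and> part ka (Suc i) < part ta i}" (is "?A = ?B")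
  proof (intro equalityI subsetI)
    fix c assume "c \<in> ?A"
    then show "c \<in> ?B"
      by (cases c) (auto simp: removable_corner_def blocked_def mem_diagram)
  next
    fix c assume "c \<in> ?B"
    then obtain i where i: "c = (i, part ta i)" "1 \<le> i" "part ka (Suc i) < part ta i" by auto
    moreover have "part ta (Suc i) \<le> part ka (Suc i)" using assms i by (auto simp: interlaced_def)
    ultimately show "c \<in> ?A"
      by (auto simp: removable_corner_def blocked_def mem_diagram)
  qed
  then show ?thesis by (simp add: r_number_def)
qed

section \<open>Cores of unions of rectangles\<close>

lemma core_of_rec:
  assumes "\<forall>m\<in>set ms. m \<le> k" "1 \<le> i" "i \<le> length ms"
  shows "part (core_of k ms) i = part ms i + part (core_of k ms) (i + (Suc k - part ms i))"
  using assms
proof (induction ms arbitrary: i)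
  case (Cons m ms)
  show ?case
  proof (cases "i = 1")
    case True
    have "1 + (Suc k - m) = Suc (Suc k - m)" "Suc k - m \<noteq> 0" using Cons.prems by auto
    then show ?thesis using True by simp
  next
    case False
    then obtain i' where "i = Suc i'" "1 \<le> i'" using Cons.prems by (cases i) auto
    then show ?thesis using Cons.IH [of i'] Cons.prems by simp
  qed
qed simp

text \<open>A smaller part reads a higher row, which is no longer. Hence the length of a core row
  determines its bounded part once the rows above are known; this is how bounded partitions are
  recovered from cores below.\<close>

lemma core_row_strict_mono:
  assumes "is_partition ka" "m < m'" "m' \<le> k"
  shows "m + part ka (i + (Suc k - m)) < m' + part ka (i + (Suc k - m'))"
proof -
  have "part ka (i + (Suc k - m)) \<le> part ka (i + (Suc k - m'))"
    using assms by (intro part_mono) auto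
  with assms show ?thesis by simp
qed

lemma core_row_inj:
  assumes "is_partition ka" "m \<le> k" "m' \<le> k"
    and "m + part ka (i + (Suc k - m)) = m' + part ka (i + (Suc k - m'))"
  shows "m = m'"
  using assms core_row_strict_mono [of ka m m' k i] core_row_strict_mono [of ka m' m k i]
  by (metis less_irrefl linorder_neqE_nat)

lemma core_of_eq_Cons:
  "core_of k mu = x # ka \<longleftrightarrow>
     (\<exists>m ms. mu = m # ms \<and> core_of k ms = ka \<and> x = m + part ka (Suc k - m))"
  by (cases mu) auto

text \<open>The copy that has p copies of t above it reads row k + 1 - t - p of the core of
  \<open>ms\<close>. For p < k - t these indices stay at least 2, so row 1 is never read; only the
  last row of a full rectangle reads it, which is why q stops at k - t.\<close>

lemma core_of_replicate:
  assumes "\<And>i. 2 \<le> i \<Longrightarrow> i \<le> Suc k - t \<Longrightarrow> part (core_of k ms) i = S" "q \<le> k - t"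
  shows "core_of k (replicate q t @ ms) = replicate q (t + S) @ core_of k ms"
  using assms(2)
proof (induction q)
  case (Suc q)
  then have "part (core_of k ms) (Suc k - t - q) = S" "\<not> Suc k - t \<le> q"
    using assms(1) [of "Suc k - t - q"] by auto
  with Suc show ?case by (simp add: part_append)
qed simp

lemma core_of_eq_replicate:
  assumes "is_partition (replicate q (t + S) @ ka)" "core_of k mu = replicate q (t + S) @ ka"
    and "\<forall>m\<in>set mu. m \<le> k" "t \<le> k" "q \<le> k - t"
    and "\<And>i. 2 \<le> i \<Longrightarrow> i \<le> Suc k - t \<Longrightarrow> part ka i = S"
  shows "\<exists>ms. mu = replicate q t @ ms \<and> core_of k ms = ka"
  using assms
proof (induction q arbitrary: mu)
  case (Suc q)
  let ?R = "replicate q (t + S) @ ka"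
  from Suc.prems(2) obtain m ms where mu: "mu = m # ms" "core_of k ms = ?R"
    and m: "t + S = m + part ?R (Suc k - m)"
    by (auto simp: core_of_eq_Cons)
  have R: "is_partition ?R" using Suc.prems by (simp add: is_partition_Cons)
  have "part ?R (Suc k - t) = part ka (Suc k - t - q)"
    using Suc.prems(5) by (auto simp: part_append)
  also have "\<dots> = S" using Suc.prems by auto
  finally have "m = t"
    using core_row_inj [OF R, of m k t 0] m mu Suc.prems by simp
  then show ?case using Suc.IH [of ms] Suc.prems mu R by auto
qed simp

lemma interlaced_Cons:
  assumes "0 < y"
  shows "interlaced ka (y # ta) \<longleftrightarrow>
    (\<exists>x ka'. ka = x # ka' \<and> y \<le> x \<and> part ka' 1 \<le> y \<and> interlaced ka' ta)"
proof
  assume h: "interlaced ka (y # ta)"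
  then have "y \<le> part ka 1" by (auto simp: interlaced_def)
  then obtain x ka' where ka: "ka = x # ka'" using assms by (cases ka) auto
  have "part ta i \<le> part ka' i \<and> part ka' (Suc i) \<le> part ta i" if "1 \<le> i" for i
    using h that ka unfolding interlaced_def by (elim allE [of _ "Suc i"]) auto
  then show "\<exists>x ka'. ka = x # ka' \<and> y \<le> x \<and> part ka' 1 \<le> y \<and> interlaced ka' ta"
    using h ka unfolding interlaced_def by (auto elim!: allE [of _ 1])
next
  assume "\<exists>x ka'. ka = x # ka' \<and> y \<le> x \<and> part ka' 1 \<le> y \<and> interlaced ka' ta"
  then obtain x ka' where ka: "ka = x # ka'" "y \<le> x" "part ka' 1 \<le> y" "interlaced ka' ta" by auto
  show "interlaced ka (y # ta)"
    unfolding interlaced_def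
  proof (intro allI impI)
    fix i :: nat assume "1 \<le> i"
    then show "part (y # ta) i \<le> part ka i \<and> part ka (Suc i) \<le> part (y # ta) i"
      using ka by (cases i) (auto simp: interlaced_def Suc_le_eq)
  qed
qed

text \<open>In a block of equal rows a horizontal strip can lengthen only the lowest one, and the
  bound on row 1 of \<open>ka\<close> prevents that as well.\<close>

lemma interlaced_replicate:
  assumes "0 < c" "part ka 1 \<le> c" "interlaced ka (replicate q c @ ta)"
  shows "\<exists>ka'. ka = replicate q c @ ka' \<and> part ka' 1 \<le> c \<and> interlaced ka' ta"
  using assms(2,3)
proof (induction q arbitrary: ka)
  case (Suc q)
  then obtain x ka' where ka: "ka = x # ka'" "c \<le> x" "part ka' 1 \<le> c" "interlaced ka' (replicate q c @ ta)"
    using interlaced_Cons [OF assms(1)] by auto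
  with Suc.prems have "x = c" by simp
  with Suc.IH [of ka'] ka show ?case by auto
qed simp

lemma is_partition_append:
  "is_partition (xs @ ys) \<longleftrightarrow> is_partition xs \<and> is_partition ys \<and> (\<forall>x\<in>set xs. \<forall>y\<in>set ys. y \<le> x)"
  by (auto simp: is_partition_def sorted_wrt_append)

lemma is_partition_replicate: "0 < c \<Longrightarrow> is_partition (replicate q c)"
  by (induction q) (auto simp: is_partition_Cons)

lemma bounded_partitions_iff:
  "la \<in> bounded_partitions k \<longleftrightarrow> is_partition la \<and> (\<forall>x\<in>set la. x \<le> k)"
  by (induction la) (auto simp: bounded_partitions_def is_partition_Cons)

lemma mset_part_union [simp]: "mset (la \<uplus> mu) = mset la + mset mu"
  by (simp add: part_union_def)

lemma set_part_union [simp]: "set (la \<uplus> mu) = set la \<union> set mu"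
  by (simp add: part_union_def)

lemma part_union_eqI:
  assumes "is_partition xs" "mset xs = mset la + mset mu"
  shows "la \<uplus> mu = xs"
proof -
  have "sort (la @ mu) = rev xs"
    using assms by (intro properties_for_sort) (auto simp: is_partition_def sorted_wrt_rev)
  then show ?thesis by (simp add: part_union_def)
qed

lemma part_union_Nil [simp]: "is_partition la \<Longrightarrow> la \<uplus> [] = la"
  by (rule part_union_eqI) auto

lemma is_partition_part_union:
  "is_partition la \<Longrightarrow> is_partition mu \<Longrightarrow> is_partition (la \<uplus> mu)"
  by (auto simp: is_partition_def part_union_def sorted_wrt_rev)

lemma is_partition_one_part [simp]: "is_partition (one_part u)"
  by (simp add: one_part_def is_partition_Cons)

lemma one_part_0 [simp]: "one_part 0 = []"
  by (simp add: one_part_def)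

lemma set_one_part_le: "x \<in> set (one_part u) \<Longrightarrow> x \<le> u"
  by (simp add: one_part_def split: if_splits)

lemma sum_list_one_part [simp]: "sum_list (one_part u) = u"
  by (simp add: one_part_def)

lemma part_one_part: "part (one_part u) i = (if i = 1 then u else 0)"
  by (auto simp: one_part_def part_def)

lemma sum_list_part_union [simp]: "sum_list (la \<uplus> mu) = sum_list la + sum_list mu"
  by (metis mset_append mset_part_union sum_list_append sum_mset_sum_list)

section \<open>Cores of stacked rectangles and the strips over them\<close>

definition rects :: "nat \<Rightarrow> nat list \<Rightarrow> nat list" where
  "rects k ts = concat (map (rect k) ts)"

text \<open>The core of the union of the rectangles listed in \<open>ts\<close> and one further part \<open>u\<close>: the part
  \<open>u\<close> lengthens the bottom row of each rectangle.\<close>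

fun rect_core :: "nat \<Rightarrow> nat list \<Rightarrow> nat \<Rightarrow> nat list" where
  "rect_core k [] u = one_part u"
| "rect_core k (t # ts) u =
     (t + sum_list ts + u) # replicate (k - t) (t + sum_list ts) @ rect_core k ts (min u t)"

definition widths :: "nat \<Rightarrow> nat list \<Rightarrow> bool" where
  "widths k ts \<longleftrightarrow> is_partition ts \<and> (\<forall>t\<in>set ts. t \<le> k)"

lemma widths_Cons:
  "widths k (t # ts) \<longleftrightarrow> 1 \<le> t \<and> t \<le> k \<and> (\<forall>t'\<in>set ts. t' \<le> t) \<and> widths k ts"
  by (auto simp: widths_def is_partition_Cons)

lemma widths_Nil [simp]: "widths k []"
  by (simp add: widths_def)

lemma rects_Nil [simp]: "rects k [] = []"
  by (simp add: rects_def)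

lemma rects_Cons: "widths k (t # ts) \<Longrightarrow> rects k (t # ts) = replicate (Suc k - t) t @ rects k ts"
  by (simp add: rects_def rect_def widths_Cons)

lemma set_rects_subset: "set (rects k ts) \<subseteq> set ts"
  by (auto simp: rects_def rect_def split: if_splits)

lemma is_partition_rects: "widths k ts \<Longrightarrow> is_partition (rects k ts)"
proof (induction ts)
  case (Cons t ts)
  then show ?case using set_rects_subset [of k ts]
    by (auto simp: rects_Cons is_partition_append is_partition_replicate widths_Cons)
qed simp

lemma part_rect_core_1 [simp]: "part (rect_core k ts u) (Suc 0) = sum_list ts + u"
  by (cases ts) (auto simp: one_part_def)

text \<open>The widest rectangle in \<open>ts\<close> has at least k + 1 - t0 rows, and only its
  lowest row depends on u.\<close>

lemma part_rect_core:
  assumes "\<forall>t\<in>set ts. t \<le> t0" "2 \<le> i" "i \<le> Suc k - t0"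
  shows "part (rect_core k ts u) i = sum_list ts"
proof (cases ts)
  case (Cons t ts')
  with assms have "i - 1 \<le> k - t" by auto
  then show ?thesis using assms Cons by (cases i) (auto simp: part_append part_replicate)
qed (use assms in \<open>auto simp: part_one_part\<close>)

lemma interlaced_replicateI:
  assumes "0 < c" "part ka 1 \<le> c" "interlaced ka ta"
  shows "interlaced (replicate q c @ ka) (replicate q c @ ta)"
  using assms
proof (induction q)
  case (Suc q)
  then show ?case by (cases q) (auto simp: interlaced_Cons)
qed simp

lemma interlaced_rect_core: "widths k ts \<Longrightarrow> interlaced (rect_core k ts u) (rect_core k ts 0)"
proof (induction ts arbitrary: u)
  case Nil
  then show ?case by (simp add: interlaced_def part_one_part)
next
  case (Cons t ts)
  then have t: "1 \<le> t" "widths k ts" by (auto simp: widths_Cons)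
  have "interlaced (replicate (k - t) (t + sum_list ts) @ rect_core k ts (min u t))
      (replicate (k - t) (t + sum_list ts) @ rect_core k ts 0)"
    using t Cons.IH by (intro interlaced_replicateI) auto
  then show ?case
    using t by (cases "k - t") (auto simp: interlaced_Cons)
qed

lemma core_of_rects:
  assumes "widths k ts" "u \<le> k"
  shows "core_of k (rects k ts \<uplus> one_part u) = rect_core k ts u"
  using assms
proof (induction ts arbitrary: u)
  case Nil
  have "[] \<uplus> one_part u = one_part u" by (rule part_union_eqI) auto
  then show ?case by (simp add: one_part_def)
next
  case (Cons t ts)
  note w = \<open>widths k (t # ts)\<close>
  have t: "1 \<le> t" "t \<le> k" "\<forall>t'\<in>set ts. t' \<le> t" "widths k ts" using w by (auto simp: widths_Cons)
  have sub: "set (rects k ts) \<subseteq> set ts" by (rule set_rects_subset)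
  have row: "core_of k (replicate (k - t) t @ (rects k ts \<uplus> one_part u')) =
      replicate (k - t) (t + sum_list ts) @ rect_core k ts u'" if "u' \<le> t" for u'
    using Cons.IH [of u'] part_rect_core [of ts t _ k u'] t that
    by (subst core_of_replicate [where S = "sum_list ts"]) auto
  have part: "is_partition (rects k ts \<uplus> one_part u')" for u'
    using t by (intro is_partition_part_union is_partition_rects) auto
  have rep: "replicate (Suc k - t) t = t # replicate (k - t) t"
    using t by (metis Suc_diff_le replicate_Suc)
  show ?case
  proof (cases "u \<le> t")
    case True
    have "rects k (t # ts) \<uplus> one_part u = t # replicate (k - t) t @ (rects k ts \<uplus> one_part u)"
    proof (rule part_union_eqI)
      show "is_partition (t # replicate (k - t) t @ (rects k ts \<uplus> one_part u))"
        using t sub part [of u] True set_one_part_le [of _ u]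
        by (fastforce simp: is_partition_Cons is_partition_append is_partition_replicate)
    qed (simp add: rects_Cons [OF w] rep)
    then show ?thesis
      using row [OF True] True t by (simp add: part_append Suc_diff_le)
  next
    case False
    \<comment> \<open>A part wider than t goes below the rectangle. One of the k + 1 - t copies of t
      is then left over and acts as the part inserted into the narrower rectangles, whence the
      \<open>min u t\<close> in \<open>rect_core\<close>.\<close>
    have "rects k (t # ts) \<uplus> one_part u = u # replicate (k - t) t @ (rects k ts \<uplus> one_part t)"
    proof (rule part_union_eqI)
      show "is_partition (u # replicate (k - t) t @ (rects k ts \<uplus> one_part t))"
        using t sub part [of t] False set_one_part_le [of _ t]
        by (fastforce simp: is_partition_Cons is_partition_append is_partition_replicate)
    qed (use t False in \<open>simp add: rects_Cons [OF w] rep one_part_def\<close>)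
    moreover have "1 \<le> Suc k - u" "Suc k - u \<le> k - t"
      using False Cons.prems by auto
    then have "part (replicate (k - t) (t + sum_list ts) @ rect_core k ts t) (Suc k - u) = t + sum_list ts"
      by (simp add: part_append part_replicate)
    ultimately show ?thesis
      using row [of t] False by simp
  qed
qed

text \<open>Induction removes the widest rectangle; e' is the growth of the lowest row of the
  remaining ones, at most t by interlacing. If the bottom part m is t, then e = e'. If m exceeds t,
  then e = m and the size misses the bound by at least t - e', so equality requires that a whole
  part t is inserted above.\<close>

lemma rect_core_strip_bound:
  assumes "widths k ts" "mu \<in> bounded_partitions k"
    and "interlaced (core_of k mu) (rect_core k ts 0)"
    and "part (core_of k mu) 1 = sum_list ts + e" "e \<le> k"
  shows "sum_list mu \<le> sum_list (rects k ts) + e \<and>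
    (sum_list mu = sum_list (rects k ts) + e \<longrightarrow> mset mu = mset (rects k ts) + mset (one_part e))"
  using assms
proof (induction ts arbitrary: mu e)
  case Nil
  show ?case
  proof (cases mu)
    case Nil
    then show ?thesis using Nil.prems by (simp add: one_part_def)
  next
    case (Cons m ms)
    have "part (core_of k mu) (Suc 1) \<le> part (rect_core k [] 0) 1"
      using Nil.prems(3) unfolding interlaced_def by blast
    then have "part (core_of k mu) 2 = 0"
      by (simp add: one_part_def numeral_2_eq_2)
    then have "length mu < 2"
      using part_pos [OF is_partition_core_of [OF Nil.prems(2)], of 2] by force
    then show ?thesis using Nil.prems Cons by (auto simp: one_part_def bounded_partitions_Cons)
  qed
next
  case (Cons t ts)
  note w = \<open>widths k (t # ts)\<close>
  have t: "1 \<le> t" "t \<le> k" "\<forall>t'\<in>set ts. t' \<le> t" "widths k ts" using w by (auto simp: widths_Cons)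
  define S where "S = sum_list ts"
  from Cons.prems(3) t obtain x ka1 where ka1: "core_of k mu = x # ka1" "part ka1 1 \<le> t + S"
      "interlaced ka1 (replicate (k - t) (t + S) @ rect_core k ts 0)"
    by (auto simp: interlaced_Cons S_def)
  from interlaced_replicate [OF _ this(2,3)] t obtain ka2
    where ka2: "ka1 = replicate (k - t) (t + S) @ ka2" "part ka2 1 \<le> t + S"
      "interlaced ka2 (rect_core k ts 0)" by auto
  have x: "x = t + S + e" using Cons.prems(4) ka1 by (simp add: S_def)
  obtain m ms where mu: "mu = m # ms" "core_of k ms = ka1" "x = m + part ka1 (Suc k - m)"
    using ka1(1) by (auto simp: core_of_eq_Cons)
  have m: "1 \<le> m" "m \<le> k" and ms: "ms \<in> bounded_partitions k"
    using mu Cons.prems(2) by (auto simp: bounded_partitions_Cons)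
  have pka1: "is_partition ka1" using is_partition_core_of [OF ms] mu by simp
  \<comment> \<open>Row i lies between rows i and i - 1 of \<open>rect_core k ts 0\<close>. For i =
    2 the latter is row 1, which also has length S because the inserted part is 0.\<close>
  have ka2_S: "part ka2 i = S" if "2 \<le> i" "i \<le> Suc k - t" for i
  proof -
    have "part (rect_core k ts 0) i = S" "part (rect_core k ts 0) (i - 1) = S"
      using that part_rect_core [of ts t i k 0] part_rect_core [of ts t "i - 1" k 0] t
      by (cases "i = 2"; simp add: S_def)+
    moreover have "part (rect_core k ts 0) i \<le> part ka2 i" "part ka2 (Suc (i - 1)) \<le> part (rect_core k ts 0) (i - 1)"
      using that spec [OF ka2(3) [unfolded interlaced_def], of i]
        spec [OF ka2(3) [unfolded interlaced_def], of "i - 1"] by auto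
    ultimately show ?thesis using that by simp
  qed
  have "\<exists>ms'. ms = replicate (k - t) t @ ms' \<and> core_of k ms' = ka2"
    using core_of_eq_replicate [of "k - t" t S ka2 k ms] ka2_S pka1 mu ka2(1) t ms
    by (auto simp: bounded_partitions_iff)
  then obtain mu' where mu': "ms = replicate (k - t) t @ mu'" "core_of k mu' = ka2" by auto
  have mu'_bd: "mu' \<in> bounded_partitions k"
    using ms mu' by (auto simp: bounded_partitions_iff is_partition_append)
  define e' where "e' = part ka2 1 - S"
  have "S \<le> part ka2 1"
    using ka2(3) part_rect_core_1 [of k ts 0] unfolding interlaced_def S_def by (metis One_nat_def add.right_neutral le_refl)
  then have e': "part ka2 1 = S + e'" "e' \<le> t" using ka2(2) by (auto simp: e'_def)
  have IH: "sum_list mu' \<le> sum_list (rects k ts) + e'"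
      "sum_list mu' = sum_list (rects k ts) + e' \<longrightarrow> mset mu' = mset (rects k ts) + mset (one_part e')"
    using Cons.IH [of mu' e'] t mu'_bd ka2 mu' e' by (auto simp: S_def)
  have rep: "replicate (Suc k - t) t = t # replicate (k - t) t"
    using t by (metis Suc_diff_le replicate_Suc)
  consider "m < t" | "m = t" | "t < m" by linarith
  then show ?case
  proof cases
    case 1
    \<comment> \<open>Impossible case: a part below t reads row 2 or a higher row of
      \<open>ka2\<close>, of length at most S, so the bottom row would be shorter than t +
      S.\<close>
    have "part ka1 (Suc k - m) = part ka2 (Suc k - m - (k - t))"
      using 1 t ka2 by (simp add: part_append)
    also have "\<dots> \<le> part ka2 2"
      using 1 t pka1 ka2 by (intro part_mono) (auto simp: is_partition_append)
    also have "\<dots> \<le> part (rect_core k ts 0) 1"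
      using ka2(3) unfolding interlaced_def by (metis le_refl Suc_1)
    finally show ?thesis using 1 mu(3) x by (simp add: S_def)
  next
    case 2
    then have "part ka1 (Suc k - m) = part ka2 1" using t ka2 by (simp add: part_append Suc_diff_le)
    then have "e = e'" using 2 mu(3) x e' by simp
    then show ?thesis
      using IH 2 mu(1) mu'(1) by (auto simp: rects_Cons [OF w] rep)
  next
    case 3
    then have "1 \<le> Suc k - m" "Suc k - m \<le> k - t" using m by auto
    then have "part ka1 (Suc k - m) = t + S"
      using ka2 by (simp add: part_append part_replicate)
    then have "e = m" using mu(3) x by simp
    have "mset mu = mset (rects k (t # ts)) + mset (one_part e)"
      if "sum_list mu = sum_list (rects k (t # ts)) + e"
    proof -
      have "sum_list mu' = sum_list (rects k ts) + t"
        using that mu(1) mu'(1) \<open>e = m\<close> by (simp add: rects_Cons [OF w] rep)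
      then have "e' = t" using IH(1) e' by simp
      then show ?thesis
        using IH(2) \<open>sum_list mu' = _\<close> mu(1) mu'(1) \<open>e = m\<close> m t
        by (simp add: rects_Cons [OF w] rep one_part_def)
    qed
    then show ?thesis
      using IH(1) e'(2) mu(1) mu'(1) \<open>e = m\<close> by (auto simp: rects_Cons [OF w] rep)
  qed
qed

section \<open>Residues of strips over stacked rectangles\<close>

lemma part_strip_rect_core:
  assumes "interlaced ka (rect_core k ts 0)" "\<forall>t\<in>set ts. t \<le> t0" "2 \<le> i" "i \<le> Suc k - t0"
  shows "part ka i = sum_list ts"
proof -
  have "part (rect_core k ts 0) i = sum_list ts"
    using assms by (intro part_rect_core) auto
  moreover have "part (rect_core k ts 0) (i - 1) = sum_list ts"
    using assms part_rect_core [of ts t0 "i - 1" k 0] by (cases "i = 2") auto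
  moreover have "part (rect_core k ts 0) i \<le> part ka i" "part ka (Suc (i - 1)) \<le> part (rect_core k ts 0) (i - 1)"
    using assms(3) spec [OF assms(1) [unfolded interlaced_def], of i]
      spec [OF assms(1) [unfolded interlaced_def], of "i - 1"] by auto
  ultimately show ?thesis using assms(3) by simp
qed

lemma strip_rect_core_le:
  assumes "interlaced ka (rect_core k ts 0)" "2 \<le> i" "is_partition ka"
  shows "part ka i \<le> sum_list ts"
proof -
  have "part ka i \<le> part ka (Suc 1)" using assms by (intro part_mono) auto
  also have "\<dots> \<le> part (rect_core k ts 0) 1"
    using assms(1) unfolding interlaced_def by blast
  finally show ?thesis by simp
qed

lemma part_rect_core_Cons:
  assumes "t \<le> k" "1 \<le> i"
  shows "part (rect_core k (t # ts) u) i =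
    (if i = 1 then t + sum_list ts + u else if i \<le> Suc k - t then t + sum_list ts
     else part (rect_core k ts (min u t)) (i - (Suc k - t)))"
proof (cases i)
  case (Suc i')
  with assms show ?thesis by (auto simp: part_append part_replicate Suc_diff_le Suc_le_eq)
qed (use assms in auto)

lemma rect_shift_mod:
  assumes "t \<le> k"
  shows "(p - int (i + (Suc k - t))) mod (int k + 1) = (p - int i + int t) mod (int k + 1)"
proof -
  have "p - int (i + (Suc k - t)) = (p - int i + int t) - (int k + 1)"
    using assms by auto
  then show ?thesis by (metis minus_mod_self2)
qed

lemma rect_shift_residue:
  fixes y S t :: nat
  assumes "(int j - int i) mod (int k + 1) = (int y + int S) mod (int k + 1)" "t \<le> k"
  shows "(int j - int (i + (Suc k - t))) mod (int k + 1) = (int y + int (t + S)) mod (int k + 1)"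
proof -
  have "(int j - int i + int t) mod (int k + 1) = ((int y + int S) + int t) mod (int k + 1)"
    using assms(1) by (rule mod_add_cong) simp
  then show ?thesis using rect_shift_mod [OF assms(2)] by (simp add: add_ac)
qed

text \<open>The u residues are those of the cells added to the bottom row. By
  \<open>rect_shift_residue\<close> each higher rectangle repeats an initial piece of this sequence,
  cut off at \<open>min u t\<close>.\<close>

lemma rect_core_residues:
  assumes "widths k ts" "1 \<le> i" "part (rect_core k ts 0) i < j" "j \<le> part (rect_core k ts u) i"
  shows "\<exists>y<u. residue k (i, j) = (int y + int (sum_list ts)) mod (int k + 1)"
  using assms
proof (induction ts arbitrary: i u)
  case Nil
  then show ?case by (intro exI [of _ "j - 1"]) (auto simp: part_one_part residue_def split: if_splits)
next
  case (Cons t ts)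
  have t: "t \<le> k" "widths k ts" using Cons.prems by (auto simp: widths_Cons)
  show ?case
  proof (cases "i = 1")
    case True
    then have "t + sum_list ts < j" "j \<le> t + sum_list ts + u" using Cons.prems by auto
    then show ?thesis
      using True by (intro exI [of _ "j - 1 - (t + sum_list ts)"]) (auto simp: residue_def)
  next
    case False
    define i' where "i' = i - (Suc k - t)"
    have i: "i > Suc k - t" "part (rect_core k ts 0) i' < j" "j \<le> part (rect_core k ts (min u t)) i'"
      using Cons.prems False t
      by (auto simp: part_rect_core_Cons i'_def simp del: rect_core.simps split: if_splits)
    moreover have "1 \<le> i'" using i(1) by (simp add: i'_def)
    ultimately obtain y where "y < min u t" "residue k (i', j) = (int y + int (sum_list ts)) mod (int k + 1)"
      using Cons.IH [of i' "min u t"] t by blast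
    then show ?thesis
      using rect_shift_residue [of j i' k y "sum_list ts" t] t i(1)
      by (intro exI [of _ y]) (auto simp: residue_def i'_def simp del: of_nat_add)
  qed
qed

text \<open>The corner at the top of the rectangle of width t is blocked once the row above it has
  grown by t, that is, when t is at most u. Its residue depends on t and the total width only, so
  repeated rectangles contribute a single residue.\<close>

lemma rect_core_corners:
  assumes "widths k ts"
  shows "(\<lambda>i. residue k (i, part (rect_core k ts 0) i)) `
      {i. 1 \<le> i \<and> part (rect_core k ts u) (Suc i) < part (rect_core k ts 0) i} =
    (\<lambda>t. (int t + int (sum_list ts)) mod (int k + 1)) ` {t \<in> set ts. u < t}"
  using assms
proof (induction ts arbitrary: u)
  case Nil
  have "{i. 1 \<le> i \<and> part (rect_core k [] u) (Suc i) < part (rect_core k [] 0) i} = {}"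
    by (auto simp: part_one_part)
  then show ?case by simp
next
  case (Cons t ts)
  have t: "1 \<le> t" "t \<le> k" "\<forall>t'\<in>set ts. t' \<le> t" "widths k ts" using Cons.prems by (auto simp: widths_Cons)
  let ?n = "Suc k - t"
  let ?I = "\<lambda>ts u. {i. 1 \<le> i \<and> part (rect_core k ts u) (Suc i) < part (rect_core k ts 0) i}"
  let ?f = "\<lambda>ts i. residue k (i, part (rect_core k ts 0) i)"
  have I: "?I (t # ts) u = (if u < t then {?n} else {}) \<union> (\<lambda>i. i + ?n) ` ?I ts (min u t)" (is "_ = ?R")
  proof (intro equalityI subsetI)
    fix i assume i: "i \<in> ?I (t # ts) u"
    show "i \<in> ?R"
    proof (cases "i \<le> ?n")
      case True
      have "\<not> Suc i \<le> ?n"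
        using i t by (auto simp: part_rect_core_Cons simp del: rect_core.simps split: if_splits)
      with True have "i = ?n" by simp
      moreover have "u < t"
        using i t by (auto simp: part_rect_core_Cons \<open>i = ?n\<close> simp del: rect_core.simps split: if_splits)
      ultimately show ?thesis by simp
    next
      case False
      then obtain i' where i': "i = i' + ?n" "1 \<le> i'"
        by (metis add.commute le_add_diff_inverse less_eq_Suc_le linorder_not_le nat_less_le
            zero_less_diff One_nat_def)
      then have "i' \<in> ?I ts (min u t)"
        using i t by (auto simp: part_rect_core_Cons simp del: rect_core.simps split: if_splits)
      then show ?thesis using i' by auto
    qed
  next
    fix i assume "i \<in> ?R"
    then consider "u < t" "i = ?n" | i' where "i = i' + ?n" "i' \<in> ?I ts (min u t)"
      by (auto split: if_splits)
    then show "i \<in> ?I (t # ts) u"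
    proof cases
      case 1
      then show ?thesis using t by (auto simp: part_rect_core_Cons simp del: rect_core.simps)
    next
      case 2
      then show ?thesis using t by (auto simp: part_rect_core_Cons simp del: rect_core.simps)
    qed
  qed
  have T: "{t' \<in> set (t # ts). u < t'} = (if u < t then {t} else {}) \<union> {t' \<in> set ts. min u t < t'}"
    using t by (auto simp: min_def)
  have shift: "?f (t # ts) (i + ?n) = (?f ts i + int t) mod (int k + 1)" if "1 \<le> i" for i
  proof -
    have "part (rect_core k (t # ts) 0) (i + ?n) = part (rect_core k ts 0) i"
      using that t by (subst part_rect_core_Cons) auto
    then show ?thesis
      using rect_shift_mod [OF t(2)] by (simp add: residue_def mod_simps del: rect_core.simps of_nat_add)
  qed
  have "?f (t # ts) ` ?I (t # ts) u =
      (if u < t then {?f (t # ts) ?n} else {}) \<union> (\<lambda>x. (x + int t) mod (int k + 1)) ` ?f ts ` ?I ts (min u t)"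
    unfolding I image_Un image_image using shift by (auto simp: image_iff)
  also have "?f (t # ts) ?n = (int t + int (sum_list (t # ts))) mod (int k + 1)"
  proof -
    have "part (rect_core k (t # ts) 0) ?n = t + sum_list ts"
      using t by (subst part_rect_core_Cons) auto
    then show ?thesis
      using rect_shift_mod [OF t(2), of "int (t + sum_list ts)" 0]
      by (simp add: residue_def add_ac del: rect_core.simps)
  qed
  also have "?f ts ` ?I ts (min u t) =
      (\<lambda>t. (int t + int (sum_list ts)) mod (int k + 1)) ` {t' \<in> set ts. min u t < t'}"
    using Cons.IH t by blast
  also have "(\<lambda>x. (x + int t) mod (int k + 1)) ` \<dots> =
      (\<lambda>t'. (int t' + int (sum_list (t # ts))) mod (int k + 1)) ` {t' \<in> set ts. min u t < t'}"
    by (simp add: image_image mod_simps add_ac)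
  finally show ?case unfolding T by (auto simp: image_Un)
qed

section \<open>A partition with wider rows placed below the rectangles\<close>

lemma core_of_append:
  "\<exists>zs. core_of k (xs @ ys) = zs @ core_of k ys \<and> length zs = length xs"
  by (induction xs) (auto intro: exI [of _ "_ # _"])

lemma part_core_of_append:
  assumes "1 \<le> j"
  shows "part (core_of k (xs @ ys)) (length xs + j) = part (core_of k ys) j"
  using core_of_append [of k xs ys] assms by (auto simp: part_append)

text \<open>Sizes up to r are allowed, not only r itself, because the rule for h_r runs over all of
  them. The rectangles do not enter, so that one index set serves the expansion with them and the
  one without.\<close>

definition strips :: "nat \<Rightarrow> nat list \<Rightarrow> nat \<Rightarrow> (nat list \<times> nat) set" where
  "strips k lb r = {(nb, u). length nb = length lb \<and>
     (\<forall>i\<in>{1..length lb}. part lb i \<le> part nb i \<and> part nb (Suc i) \<le> part lb i) \<and>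
     part nb 1 + length lb \<le> Suc k \<and> sum_list nb + u \<le> sum_list lb + r}"

text \<open>The condition \<open>lb_hook\<close> bounds the main hook of \<open>lb\<close> by k; for
  nonempty \<open>lb\<close> it is the containment in the rectangle R_t with t = k + 1 - l. The
  strictness of \<open>ts_less\<close> separates the residues of the rectangle corners from those of
  the rows of \<open>lb\<close>.\<close>

locale rect_stack =
  fixes k :: nat and ts lb :: "nat list"
  assumes widths: "widths k ts"
    and lb: "is_partition lb"
    and lb_hook: "part lb 1 + length lb \<le> Suc k"
    and ts_less: "\<forall>t\<in>set ts. \<forall>x\<in>set lb. t < x"
begin

abbreviation "l \<equiv> length lb"
abbreviation "S \<equiv> sum_list ts"

lemma lb_le:
  assumes "1 \<le> i" "i \<le> l"
  shows "part lb i \<le> k"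
proof -
  have "part lb i \<le> part lb 1" using lb assms by (intro part_mono) auto
  then show ?thesis using lb_hook assms by linarith
qed

lemma ts_le_last: "1 \<le> l \<Longrightarrow> t \<in> set ts \<Longrightarrow> t < part lb l"
  using ts_less part_in_set [of l lb] by auto

text \<open>Row i reads row j = i + k + 1 - part nb i - l of the rectangle core. The hook bound
  gives j at least 1, with equality only for i = 1 and main hook exactly k; this is the exceptional
  row with u more cells. Otherwise j lies between 2 and k + 1 - part nb l, where
  \<open>part_rect_core\<close> gives the length S.\<close>

lemma core_of_stack:
  assumes nb: "is_partition nb" "length nb = l" "part nb 1 + l \<le> Suc k"
    and tsn: "\<forall>t\<in>set ts. \<forall>x\<in>set nb. t < x" and u: "u \<le> k"
  defines "mu \<equiv> nb @ (rects k ts \<uplus> one_part u)"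
  shows "\<And>j. 1 \<le> j \<Longrightarrow> part (core_of k mu) (l + j) = part (rect_core k ts u) j"
    and "\<And>i. 1 \<le> i \<Longrightarrow> i \<le> l \<Longrightarrow> part (core_of k mu) i =
      S + part nb i + (if i = 1 \<and> part nb 1 + l = Suc k then u else 0)"
proof -
  show top: "part (core_of k mu) (l + j) = part (rect_core k ts u) j" if "1 \<le> j" for j
    using part_core_of_append [OF that, of k nb] core_of_rects [OF widths u] nb by (simp add: mu_def)
  fix i assume i: "1 \<le> i" "i \<le> l"
  have mono: "part nb i \<le> part nb 1" "part nb l \<le> part nb i" using nb i by (auto intro: part_mono)
  have "\<forall>m\<in>set nb. m \<le> k"
  proof
    fix m assume "m \<in> set nb"
    then obtain i where "m = part nb i" "1 \<le> i"
      by (metis in_set_conv_nth part_Suc le_add1 plus_1_eq_Suc)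
    then have "m \<le> part nb 1" using nb by (auto intro: part_mono)
    then show "m \<le> k" using nb i by linarith
  qed
  then have "\<forall>m\<in>set mu. m \<le> k"
    using u set_one_part_le [of _ u] set_rects_subset [of k ts] widths
    by (auto simp: mu_def widths_def dest: set_one_part_le)
  then have rec: "part (core_of k mu) i = part nb i + part (core_of k mu) (i + (Suc k - part nb i))"
    using core_of_rec [of mu k i] i nb by (simp add: mu_def part_append)
  define j where "j = i + (Suc k - part nb i) - l"
  have j: "i + (Suc k - part nb i) = l + j" "1 \<le> j" "j \<le> Suc k - part nb l"
    using i mono nb by (auto simp: j_def)
  have tl: "\<forall>t\<in>set ts. t \<le> part nb l"
    using tsn part_in_set [of l nb] nb i by (auto intro: less_imp_le)
  have "part (rect_core k ts u) j = S + (if i = 1 \<and> part nb 1 + l = Suc k then u else 0)"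
  proof (cases "j = 1")
    case True
    then have "i = 1 \<and> part nb 1 + l = Suc k" using i mono nb by (auto simp: j_def)
    then show ?thesis using True by simp
  next
    case False
    then have "\<not> (i = 1 \<and> part nb 1 + l = Suc k)" by (auto simp: j_def)
    then show ?thesis using part_rect_core [OF tl _ j(3), of u] j False by auto
  qed
  then show "part (core_of k mu) i =
      S + part nb i + (if i = 1 \<and> part nb 1 + l = Suc k then u else 0)"
    using rec j top [of j] by simp
qed

lemma stripsD:
  assumes "(nb, u) \<in> strips k lb r" "r \<le> k" "\<forall>x\<in>set lb. r \<le> x"
  shows "length nb = l" "is_partition nb" "part nb 1 + l \<le> Suc k"
    and "\<forall>t\<in>set ts. \<forall>x\<in>set nb. t < x" "u \<le> r" "u \<le> k" "\<forall>x\<in>set nb. u \<le> x"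
    and "sum_list nb + u \<le> sum_list lb + r" "sum_list lb \<le> sum_list nb"
    and "\<And>i. 1 \<le> i \<Longrightarrow> i \<le> l \<Longrightarrow> part lb i \<le> part nb i"
    and "\<And>i. 1 \<le> i \<Longrightarrow> part nb (Suc i) \<le> part lb i"
proof -
  show len: "length nb = l" and "part nb 1 + l \<le> Suc k" and sum: "sum_list nb + u \<le> sum_list lb + r"
    and ge: "\<And>i. 1 \<le> i \<Longrightarrow> i \<le> l \<Longrightarrow> part lb i \<le> part nb i"
    using assms(1) by (auto simp: strips_def)
  show le: "\<And>i. 1 \<le> i \<Longrightarrow> part nb (Suc i) \<le> part lb i"
    using assms(1) part_eq_0 [of nb] by (auto simp: strips_def)
  show suml: "sum_list lb \<le> sum_list nb"
    unfolding sum_list_part len by (rule sum_mono) (use ge in auto)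
  show "u \<le> r" using sum suml by simp
  then show "u \<le> k" using assms(2) by simp
  have ex: "\<exists>y\<in>set lb. y \<le> x" if "x \<in> set nb" for x
  proof -
    from that obtain i where i: "i < length nb" "x = part nb (Suc i)" by (metis in_set_conv_nth part_Suc)
    then have "part lb (Suc i) \<in> set lb" using len by (intro part_in_set) auto
    then show ?thesis using i len ge [of "Suc i"] by auto
  qed
  show "\<forall>t\<in>set ts. \<forall>x\<in>set nb. t < x"
    using ex ts_less by (metis order_less_le_trans)
  show "\<forall>x\<in>set nb. u \<le> x"
    using ex assms(3) \<open>u \<le> r\<close> by (metis le_trans)
  have "part nb (Suc i) \<le> part nb i" if "1 \<le> i" for i
    using that ge [of i] le [of i] part_eq_0 [of nb "Suc i"] len by (cases "i \<le> l") auto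
  moreover have "0 \<notin> set nb" using ex lb by (metis is_partition_def le_zero_eq)
  ultimately show "is_partition nb" by (simp add: is_partition_part_iff)
qed

text \<open>The residue of the cell (l + 1, S + 1 + y): y numbers, from 0, the cells added to the
  lowest row of the rectangles.\<close>

definition res :: "nat \<Rightarrow> int" where
  "res y = (int y + int S - int l) mod (int k + 1)"

lemma inj_on_res: "inj_on res {0..k}"
proof (rule inj_onI)
  fix x y assume xy: "x \<in> {0..k}" "y \<in> {0..k}" "res x = res y"
  define c where "c = int S - int l"
  have "(int x + c - c) mod (int k + 1) = (int y + c - c) mod (int k + 1)"
    using xy(3) by (intro mod_diff_cong) (auto simp: res_def c_def algebra_simps)
  then show "x = y" using xy by simp
qed

text \<open>Labels on the scale of \<open>res\<close>, where the cell (i, S + v) has label v + l -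
  i. Passing to shifted parts turns the interlacing of \<open>nb\<close> and \<open>lb\<close> into
  disjointness of the intervals.\<close>

definition strip_residues :: "nat list \<Rightarrow> nat \<Rightarrow> nat set" where
  "strip_residues nb u = {0..<u} \<union> (\<Union>i\<in>{1..l}. {part lb i + l - i<..part nb i + l - i})"

lemma strip_residues_subset:
  assumes "is_partition nb" "part nb 1 + l \<le> Suc k" "u \<le> k"
  shows "strip_residues nb u \<subseteq> {0..k}"
proof
  fix y assume "y \<in> strip_residues nb u"
  then consider "y < u" | i where "1 \<le> i" "i \<le> l" "y \<le> part nb i + l - i"
    by (auto simp: strip_residues_def)
  then show "y \<in> {0..k}"
  proof cases
    case 2
    have "part nb i \<le> part nb 1" using assms 2 by (intro part_mono) auto
    then show ?thesis using 2 assms by simp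
  qed (use assms in auto)
qed

lemma card_strip_residues:
  assumes "length nb = l" "\<forall>x\<in>set lb. u \<le> x"
    and ge: "\<And>i. 1 \<le> i \<Longrightarrow> i \<le> l \<Longrightarrow> part lb i \<le> part nb i"
    and le: "\<And>i. 1 \<le> i \<Longrightarrow> part nb (Suc i) \<le> part lb i"
  shows "card (strip_residues nb u) + sum_list lb = u + sum_list nb"
proof -
  let ?A = "\<lambda>i. {part lb i + l - i<..part nb i + l - i}"
  have disj: "?A i \<inter> ?A j = {}" if "1 \<le> i" "i < j" "j \<le> l" for i j
  proof -
    have "part nb j \<le> part lb i"
      using le [of "j - 1"] part_mono [OF lb, of i "j - 1"] that by (cases j) auto
    then show ?thesis using that by auto
  qed
  have "card (strip_residues nb u) = card {0..<u} + card (\<Union>i\<in>{1..l}. ?A i)"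
    unfolding strip_residues_def
  proof (rule card_Un_disjoint)
    have "u \<le> part lb i + l - i" if "1 \<le> i" "i \<le> l" for i
      using that assms(2) part_in_set [of i lb] by fastforce
    then show "{0..<u} \<inter> (\<Union>i\<in>{1..l}. ?A i) = {}" by fastforce
  qed auto
  also have "card (\<Union>i\<in>{1..l}. ?A i) = (\<Sum>i\<in>{1..l}. card (?A i))"
  proof (rule card_UN_disjoint)
    show "\<forall>i\<in>{1..l}. \<forall>j\<in>{1..l}. i \<noteq> j \<longrightarrow> ?A i \<inter> ?A j = {}"
    proof (intro ballI impI)
      fix i j assume "i \<in> {1..l}" "j \<in> {1..l}" "i \<noteq> j"
      then show "?A i \<inter> ?A j = {}" using disj [of i j] disj [of j i] by (cases "i < j") auto
    qed
  qed auto
  also have "\<dots> = (\<Sum>i\<in>{1..l}. part nb i - part lb i)"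
    by (intro sum.cong) auto
  also have "\<dots> = sum_list nb - sum_list lb"
    unfolding sum_list_part assms(1) by (rule sum_subtractf_nat) (use ge in auto)
  finally show ?thesis
    using assms(1) ge sum_mono [of "{1..l}" "part lb" "part nb"] by (simp add: sum_list_part)
qed

lemma residue_row:
  assumes "i \<le> l"
  shows "residue k (i, S + v) = res (v + l - i)"
  using assms by (auto simp: residue_def res_def algebra_simps)

lemma residue_top:
  assumes "residue k (j, c) = (int y + int S) mod (int k + 1)"
  shows "residue k (l + j, c) = res y"
proof -
  have "(int c - int j - int l) mod (int k + 1) = (int y + int S - int l) mod (int k + 1)"
    using assms by (intro mod_diff_cong) (auto simp: residue_def)
  then show ?thesis by (simp add: residue_def res_def algebra_simps)
qed

text \<open>Only lower bounds on the rows of \<open>ka\<close> are assumed, so the estimate applies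
  before a given strip is known to have the form described by \<open>strips\<close>.\<close>

lemma strip_residues_le_card:
  assumes nb: "is_partition nb" "part nb 1 + l \<le> Suc k" "u \<le> k"
    and T: "\<And>i. 1 \<le> i \<Longrightarrow> i \<le> l \<Longrightarrow> part ta i = S + part lb i" "part ta (Suc l) = S"
    and K: "\<And>i. 1 \<le> i \<Longrightarrow> i \<le> l \<Longrightarrow> S + part nb i \<le> part ka i" "S + u \<le> part ka (Suc l)"
  shows "card (strip_residues nb u) \<le> card (residue k ` (diagram ka - diagram ta))"
proof -
  have "res ` strip_residues nb u \<subseteq> residue k ` (diagram ka - diagram ta)"
  proof
    fix x assume "x \<in> res ` strip_residues nb u"
    then obtain y where y: "x = res y" "y \<in> strip_residues nb u" by auto
    then consider "y < u" | i where "1 \<le> i" "i \<le> l" "part lb i + l - i < y" "y \<le> part nb i + l - i"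
      by (auto simp: strip_residues_def)
    then show "x \<in> residue k ` (diagram ka - diagram ta)"
    proof cases
      case 1
      have "residue k (Suc l, S + Suc y) = res y"
        by (auto simp: residue_def res_def algebra_simps)
      moreover have "(Suc l, S + Suc y) \<in> diagram ka - diagram ta"
        using 1 T K by (auto simp: mem_diagram)
      ultimately show ?thesis using y by (metis imageI)
    next
      case 2
      define v where "v = y + i - l"
      have v: "part lb i < v" "v \<le> part nb i" "v + l - i = y" using 2 by (auto simp: v_def)
      then have "(i, S + v) \<in> diagram ka - diagram ta"
        using 2 T(1) [of i] K(1) [of i] by (auto simp: mem_diagram)
      moreover have "residue k (i, S + v) = x"
        using residue_row [of i v] 2 v y by simp
      ultimately show ?thesis by (metis imageI)
    qed
  qed
  then have "card (res ` strip_residues nb u) \<le> card (residue k ` (diagram ka - diagram ta))"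
    by (intro card_mono) auto
  then show ?thesis
    using card_image [OF inj_on_subset [OF inj_on_res strip_residues_subset [OF nb]]] by simp
qed

end

definition stack :: "nat \<Rightarrow> nat list \<Rightarrow> nat list \<Rightarrow> nat \<Rightarrow> nat list" where
  "stack k ts nb u = nb @ (rects k ts \<uplus> one_part u)"

lemma sum_list_stack: "sum_list (stack k ts nb u) = sum_list nb + sum_list (rects k ts) + u"
  by (simp add: stack_def)

context rect_stack
begin

abbreviation base :: "nat list" where "base \<equiv> stack k ts lb 0"

lemma stack_bounded:
  assumes "is_partition nb" "part nb 1 \<le> k"
    and "\<forall>t\<in>set ts. \<forall>x\<in>set nb. t < x" "u \<le> k" "\<forall>x\<in>set nb. u \<le> x"
  shows "stack k ts nb u \<in> bounded_partitions k"
proof -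
  have "\<forall>x\<in>set nb. x \<le> k"
    using assms(1,2) by (metis bounded_partitions_def bounded_partitions_iff mem_Collect_eq)
  moreover have "\<forall>t\<in>set ts. t \<le> k" using widths by (simp add: widths_def)
  moreover have "is_partition (rects k ts \<uplus> one_part u)"
    by (intro is_partition_part_union is_partition_rects widths) auto
  moreover have "y \<le> x" if "x \<in> set nb" "y \<in> set (rects k ts \<uplus> one_part u)" for x y
    using that set_rects_subset [of k ts] assms set_one_part_le [of y u] by (fastforce intro: less_imp_le)
  ultimately show ?thesis
    using assms set_rects_subset [of k ts] set_one_part_le [of _ u]
    by (fastforce simp: bounded_partitions_iff stack_def is_partition_append)
qed

lemma lb_hook_le: "part lb 1 \<le> k"
  using lb_hook by (cases lb) auto

lemma base_bounded: "base \<in> bounded_partitions k"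
  using lb lb_hook_le ts_less by (intro stack_bounded) auto

lemma part_base_core:
  shows "1 \<le> j \<Longrightarrow> part (core_of k base) (l + j) = part (rect_core k ts 0) j"
    and "1 \<le> i \<Longrightarrow> i \<le> l \<Longrightarrow> part (core_of k base) i = S + part lb i"
  using core_of_stack [OF lb refl lb_hook ts_less, of 0] by (auto simp: stack_def)

lemma stack_props:
  assumes "(nb, u) \<in> strips k lb r" "r \<le> k" "\<forall>x\<in>set lb. r \<le> x"
  defines "K \<equiv> core_of k (stack k ts nb u)"
  shows "stack k ts nb u \<in> bounded_partitions k"
    and "interlaced K (core_of k base)"
    and "card (residue k ` (diagram K - diagram (core_of k base))) + sum_list lb = sum_list nb + u"
    and "\<And>j. 1 \<le> j \<Longrightarrow> part K (l + j) = part (rect_core k ts u) j"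
    and "\<And>i. 1 \<le> i \<Longrightarrow> i \<le> l \<Longrightarrow> part K i =
      S + part nb i + (if i = 1 \<and> part nb 1 + l = Suc k then u else 0)"
proof -
  note nb = stripsD [OF assms(1-3)]
  let ?T = "core_of k base"
  have "part nb 1 \<le> k" using nb(1,3) by (cases nb) auto
  then show bd: "stack k ts nb u \<in> bounded_partitions k"
    using nb by (intro stack_bounded) auto
  show Ktop: "\<And>j. 1 \<le> j \<Longrightarrow> part K (l + j) = part (rect_core k ts u) j"
    and Kbot: "\<And>i. 1 \<le> i \<Longrightarrow> i \<le> l \<Longrightarrow> part K i =
      S + part nb i + (if i = 1 \<and> part nb 1 + l = Suc k then u else 0)"
    using core_of_stack [OF nb(2,1,3,4,6)] by (auto simp: K_def stack_def)
  show "interlaced K ?T"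
    unfolding interlaced_def
  proof (intro allI impI)
    fix i :: nat assume i: "1 \<le> i"
    show "part ?T i \<le> part K i \<and> part K (Suc i) \<le> part ?T i"
    proof (cases "i \<le> l")
      case True
      have "u \<le> part lb l" using nb(5) assms(3) part_in_set [of l lb] True i by fastforce
      then have "part K (Suc i) \<le> part ?T i"
        using True i nb(11) [of i] Kbot [of "Suc i"] Ktop [of 1] part_base_core(2) [of i]
        by (cases "i = l") auto
      then show ?thesis using True i nb(10) [of i] Kbot [of i] part_base_core(2) [of i] by auto
    next
      case False
      then obtain i' where i': "i = l + i'" "1 \<le> i'"
        by (metis One_nat_def Suc_leI add.commute add_diff_cancel_left' le_add_diff_inverse2
            linorder_not_le nat_le_linear zero_less_diff)
      then show ?thesis
        using interlaced_rect_core [OF widths, of u] Ktop [of i'] Ktop [of "Suc i'"] part_base_core(1) [of i']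
        by (auto simp: interlaced_def)
    qed
  qed
  have "card (residue k ` (diagram K - diagram ?T)) = card (strip_residues nb u)"
  proof (rule antisym)
    have "residue k ` (diagram K - diagram ?T) \<subseteq> res ` strip_residues nb u"
    proof
      fix x assume "x \<in> residue k ` (diagram K - diagram ?T)"
      then obtain i j where ij: "x = residue k (i, j)" "1 \<le> i" "part ?T i < j" "j \<le> part K i"
        by (auto simp: mem_diagram)
      show "x \<in> res ` strip_residues nb u"
      proof (cases "i \<le> l")
        case False
        then obtain i' where i': "i = l + i'" "1 \<le> i'"
          by (metis less_eqE less_eq_Suc_le linorder_not_le add_Suc_shift add_Suc Suc_eq_plus1 le_add2)
        then obtain y where "y < u" "residue k (i', j) = (int y + int S) mod (int k + 1)"
          using rect_core_residues [OF widths i'(2), of j u] ij part_base_core(1) Ktop by auto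
        then show ?thesis using residue_top [of i' j y] ij(1) i' by (auto simp: strip_residues_def)
      next
        case True
        define v where "v = j - S"
        have v: "j = S + v" "part lb i < v" using ij True part_base_core(2) by (auto simp: v_def)
        have x: "x = res (v + l - i)" using residue_row [OF True] ij v by simp
        show ?thesis
        proof (cases "v \<le> part nb i")
          case True
          then have "v + l - i \<in> {part lb i + l - i<..part nb i + l - i}"
            using v \<open>i \<le> l\<close> by auto
          then show ?thesis using x ij \<open>i \<le> l\<close> by (auto simp: strip_residues_def)
        next
          case False
          then have i: "i = 1" "part nb 1 + l = Suc k" "v \<le> part nb 1 + u"
            using Kbot [OF ij(2) True] ij v by (auto split: if_splits)
          \<comment> \<open>The u exceptional cells of the bottom row have labels above k. Reduced
            by k + 1 these become labels below u, which the rectangles already use, so no new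
            residue appears.\<close>
          define y where "y = v + l - 1 - Suc k"
          have y: "y < u" "v + l - i = y + Suc k" using i False by (auto simp: y_def)
          have "res (y + Suc k) = (int y + int S - int l + 1 * (int k + 1)) mod (int k + 1)"
            by (simp add: res_def algebra_simps)
          also have "\<dots> = res y" unfolding res_def by (rule mod_mult_self1)
          finally show ?thesis using x y by (auto simp: strip_residues_def)
        qed
      qed
    qed
    moreover have "finite (strip_residues nb u)" by (simp add: strip_residues_def)
    ultimately show "card (residue k ` (diagram K - diagram ?T)) \<le> card (strip_residues nb u)"
      by (meson card_image_le card_mono finite_imageI le_trans)
    show "card (strip_residues nb u) \<le> card (residue k ` (diagram K - diagram ?T))"
      using nb part_base_core [of 1] Ktop [of 1]
      by (intro strip_residues_le_card) (auto simp: part_base_core(2) Kbot)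
  qed
  then show "card (residue k ` (diagram K - diagram ?T)) + sum_list lb = sum_list nb + u"
    using card_strip_residues [OF nb(1) _ nb(10,11), of u] nb(5) assms(3) by fastforce
qed

lemma card_row_le:
  assumes "1 \<le> i" "d \<le> part ka i - part ta i" "d \<le> Suc k"
  shows "d \<le> card (residue k ` (diagram ka - diagram ta))"
proof -
  let ?R = "(\<lambda>x. residue k (i, part ta i + Suc x)) ` {0..<d}"
  have "inj_on (\<lambda>x. residue k (i, part ta i + Suc x)) {0..<d}"
  proof (rule inj_onI)
    fix x y assume xy: "x \<in> {0..<d}" "y \<in> {0..<d}"
      "residue k (i, part ta i + Suc x) = residue k (i, part ta i + Suc y)"
    define c where "c = int (part ta i) + 1 - int i"
    have "(int x + c - c) mod (int k + 1) = (int y + c - c) mod (int k + 1)"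
      using xy(3) by (intro mod_diff_cong) (auto simp: residue_def c_def algebra_simps)
    then show "x = y" using xy assms(3) by simp
  qed
  then have "card ?R = d" by (simp add: card_image)
  moreover have "?R \<subseteq> residue k ` (diagram ka - diagram ta)"
    using assms by (auto simp: mem_diagram intro!: imageI)
  then have "card ?R \<le> card (residue k ` (diagram ka - diagram ta))"
    by (intro card_mono) auto
  ultimately show ?thesis by simp
qed

text \<open>The partition splits as \<open>nb @ mt\<close>. Counting residues gives sum nb + u at
  most sum lb + s, and \<open>rect_core_strip_bound\<close> gives sum mt at most the size of the
  rectangles plus u. The prescribed total size makes both equalities, and the second equality
  determines \<open>mt\<close>.\<close>

lemma strip_complete:
  assumes mu: "mu \<in> bounded_partitions k" and s: "s \<le> k" "\<forall>x\<in>set lb. s \<le> x"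
    and inter: "interlaced (core_of k mu) (core_of k base)"
    and sum: "sum_list mu = sum_list base + s"
    and card: "card (residue k ` (diagram (core_of k mu) - diagram (core_of k base))) = s"
  shows "\<exists>nb u. (nb, u) \<in> strips k lb s \<and> mu = stack k ts nb u \<and> sum_list nb + u = sum_list lb + s"
proof -
  define K where "K = core_of k mu"
  define T where "T = core_of k base"
  note Ttop = part_base_core(1) [folded T_def] and Tbot = part_base_core(2) [folded T_def]
  have inter': "part T i \<le> part K i" "part K (Suc i) \<le> part T i" if "1 \<le> i" for i
    using inter that by (auto simp: interlaced_def K_def T_def)
  have pK: "is_partition K" using mu by (simp add: K_def is_partition_core_of)
  have mu_le: "part mu i \<le> k" for i using mu by (intro part_le) (auto simp: bounded_partitions_iff)
  have "l \<le> length K"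
  proof (cases "l = 0")
    case False
    then have l: "1 \<le> l" by (simp add: Suc_le_eq)
    then have "0 < part T l" using Tbot [of l] part_pos [OF lb, of l] by simp
    then have "0 < part K l" using inter' [of l] l by simp
    then show ?thesis using part_eq_0 [of K l] by (metis less_irrefl linorder_not_le)
  qed simp
  define nb where "nb = take l mu"
  define mt where "mt = drop l mu"
  have muK: "length mu = length K" by (simp add: K_def)
  have munb: "mu = nb @ mt" "length nb = l"
    using \<open>l \<le> length K\<close> muK by (auto simp: nb_def mt_def)
  have mt: "mt \<in> bounded_partitions k"
    using mu munb by (auto simp: bounded_partitions_iff is_partition_append)
  define KP where "KP = core_of k mt"
  have pKP: "is_partition KP" using mt by (simp add: KP_def is_partition_core_of)
  have Ktop: "part K (l + j) = part KP j" if "1 \<le> j" for j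
    using part_core_of_append [OF that, of k nb mt] munb by (simp add: K_def KP_def)
  have interP: "interlaced KP (rect_core k ts 0)"
    unfolding interlaced_def
  proof (intro allI impI)
    fix i :: nat assume "1 \<le> i"
    then show "part (rect_core k ts 0) i \<le> part KP i \<and> part KP (Suc i) \<le> part (rect_core k ts 0) i"
      using inter' [of "l + i"] Ktop [of i] Ktop [of "Suc i"] Ttop [of i] by simp
  qed
  define u where "u = part KP 1 - S"
  have KP1: "part KP 1 = S + u"
    using interP part_rect_core_1 [of k ts 0] unfolding interlaced_def u_def
    by (metis One_nat_def add.right_neutral le_add_diff_inverse le_refl)
  \<comment> \<open>Otherwise s + 1 consecutive cells of one row would show s + 1 distinct residues;
    they are distinct because s + 1 is at most k + 1.\<close>
  have row_le: "part K i - part T i \<le> s" if "1 \<le> i" for i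
  proof (rule ccontr)
    assume "\<not> ?thesis"
    then have "Suc s \<le> s"
      using card_row_le [OF that, of "Suc s" K T] s(1) card by (simp add: K_def T_def)
    then show False by simp
  qed
  have u_last: "u \<le> part lb l" if "1 \<le> l"
    using inter'(2) [of l] Ktop [of 1] KP1 Tbot [of l] that by simp
  have uk: "u \<le> k"
  proof (cases "l = 0")
    case True
    then show ?thesis using row_le [of 1] Ktop [of 1] Ttop [of 1] KP1 s by simp
  next
    case False
    then have "1 \<le> l" by (simp add: Suc_le_eq)
    then show ?thesis using u_last lb_le [of l] by simp
  qed
  have u_lb: "\<forall>x\<in>set lb. u \<le> x"
  proof
    fix x assume "x \<in> set lb"
    then obtain i where "x = part lb (Suc i)" "Suc i \<le> l" by (metis in_set_conv_nth part_Suc Suc_leI)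
    then show "u \<le> x" using u_last part_mono [OF lb, of "Suc i" l] by simp
  qed
  have munb_part: "part mu i = part nb i" if "i \<le> l" for i
    using that munb by (simp add: part_append)
  have rec: "part K i = part nb i + part K (i + (Suc k - part nb i))" if "1 \<le> i" "i \<le> l" for i
    using core_of_rec [of mu k i] that munb munb_part mu by (simp add: K_def bounded_partitions_iff)
  have flat: "part K (l + j) = S" if "2 \<le> j" "j \<le> Suc k - part lb l" "1 \<le> l" for j
    using Ktop [of j] part_strip_rect_core [OF interP, of "part lb l" j] that ts_le_last
    by (auto intro: less_imp_le)
  have row: "part nb i = f"
    if i: "1 \<le> i" "i \<le> l" and f: "part K i = S + f" "part lb i \<le> f" "f + l \<le> k \<or> 2 \<le> i \<and> f + l \<le> Suc k" for i f
  proof -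
    define j where "j = i + (Suc k - f) - l"
    have "part lb l \<le> part lb i" using i by (intro part_mono lb)
    then have "i + (Suc k - f) = l + j" "2 \<le> j" "j \<le> Suc k - part lb l"
      using i f by (auto simp: j_def)
    then have "f + part K (i + (Suc k - f)) = part nb i + part K (i + (Suc k - part nb i))"
      using flat [of j] rec [OF i] f i by simp
    moreover have "part nb i \<le> k" using mu_le [of i] munb_part [OF i(2)] by simp
    moreover have "f \<le> k" using f i by auto
    ultimately show ?thesis using core_row_inj [OF pK] by metis
  qed
  have rows: "part lb i \<le> part nb i \<and> part nb (Suc i) \<le> part lb i \<and> S + part nb i \<le> part K i \<and>
      (i = 1 \<longrightarrow> part nb 1 + l \<le> Suc k)" if i: "1 \<le> i" "i \<le> l" for i
  proof -
    have upper: "part K i' = S + part nb i'" if i': "2 \<le> i'" "i' \<le> l" for i'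
    proof -
      define f where "f = part K i' - S"
      have "S + part lb i' \<le> part K i'" "part K i' \<le> S + part lb (i' - 1)"
        using inter'(1) [of i'] inter'(2) [of "i' - 1"] Tbot [of i'] Tbot [of "i' - 1"] i' by auto
      then have f: "part K i' = S + f" "part lb i' \<le> f" "f \<le> part lb (i' - 1)" by (auto simp: f_def)
      have "part lb (i' - 1) \<le> part lb 1" using i' by (intro part_mono lb) auto
      then show ?thesis using row [of i' f] f i' lb_hook by simp
    qed
    have bottom: "part lb 1 \<le> part nb 1 \<and> S + part nb 1 \<le> part K 1 \<and> part nb 1 + l \<le> Suc k"
    proof -
      have l: "1 \<le> l" using i by simp
      define f where "f = part K 1 - S"
      have f: "part K 1 = S + f" "part lb 1 \<le> f" using inter'(1) [of 1] Tbot [of 1] l by (auto simp: f_def)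
      show ?thesis
      proof (cases "f + l \<le> k")
        case True
        then show ?thesis using row [of 1 f] f l by simp
      next
        case False
        \<comment> \<open>The largest bottom part that the hook bound permits. A smaller m reads a
          row of length at most S and cannot produce f cells. A larger m reads a row of index at
          most l, of length at least S + part lb l, which makes f larger than part lb 1 + part lb l;
          but f is at most part lb 1 + s, and s is at most the last part of
          \<open>lb\<close>.\<close>
        define M where "M = Suc k - l"
        have M: "M \<le> k" "1 + (Suc k - M) = l + 1" "part lb 1 \<le> M" "M + l = Suc k"
          using l lb_hook part_pos [OF lb, of 1] by (auto simp: M_def)
        define m where "m = part nb 1"
        have mk: "m \<le> k" using mu_le [of 1] munb_part [of 1] l by (simp add: m_def)
        have eq: "S + f = m + part K (1 + (Suc k - m))" using rec [of 1] f l by (simp add: m_def)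
        have "\<not> m < M"
        proof
          assume "m < M"
          have "part K (1 + (Suc k - m)) \<le> part K (l + 2)"
            using \<open>m < M\<close> M by (intro part_mono pK) auto
          also have "\<dots> \<le> S" using Ktop [of 2] strip_rect_core_le [OF interP _ pKP, of 2] by simp
          finally show False using eq \<open>m < M\<close> False M by simp
        qed
        moreover have "\<not> M < m"
        proof
          assume "M < m"
          have "f \<le> part lb 1 + s" using row_le [of 1] f Tbot [of 1] l by simp
          moreover have "s \<le> part lb l" using s(2) part_in_set [of l lb] l by simp
          moreover have "S + part lb l \<le> part K l" using inter'(1) [of l] Tbot [of l] l by simp
          moreover have "part K l \<le> part K (1 + (Suc k - m))"
            using \<open>M < m\<close> M mk by (intro part_mono pK) auto
          ultimately show False using eq M \<open>M < m\<close> by simp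
        qed
        ultimately have "m = M" by simp
        then show ?thesis using M f False by (simp add: m_def)
      qed
    qed
    have "part nb (Suc i) \<le> part lb i"
    proof (cases "Suc i \<le> l")
      case True
      then show ?thesis using upper [of "Suc i"] inter'(2) [of i] Tbot [of i] i by simp
    next
      case False
      then show ?thesis using part_eq_0 [of nb "Suc i"] munb(2) by simp
    qed
    moreover have "part lb i \<le> part nb i \<and> S + part nb i \<le> part K i"
    proof (cases "i = 1")
      case False
      then show ?thesis using upper [of i] inter'(1) [of i] Tbot [of i] i by simp
    qed (use bottom in simp)
    ultimately show ?thesis using bottom by blast
  qed
  have hook: "part nb 1 + l \<le> Suc k"
    using rows [of 1] munb(2) by (cases nb) auto
  have nb: "is_partition nb" using mu munb by (auto simp: bounded_partitions_iff is_partition_append)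
  have le: "part nb (Suc i) \<le> part lb i" if "1 \<le> i" for i
    using rows [of i] that part_eq_0 [of nb "Suc i"] munb(2) by (cases "i \<le> l") auto
  have cs: "card (strip_residues nb u) + sum_list lb = u + sum_list nb"
    using card_strip_residues [OF munb(2) u_lb] rows le by blast
  have "card (strip_residues nb u) \<le> s"
    using strip_residues_le_card [OF nb hook uk, of T K] Tbot Ttop [of 1] rows Ktop [of 1] KP1 card
    by (simp add: K_def T_def)
  then have ge: "sum_list nb + u \<le> sum_list lb + s" using cs by simp
  have bound: "sum_list mt \<le> sum_list (rects k ts) + u"
    "sum_list mt = sum_list (rects k ts) + u \<longrightarrow> mset mt = mset (rects k ts) + mset (one_part u)"
    using rect_core_strip_bound [OF widths mt] interP KP1 uk by (auto simp: KP_def)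
  have "sum_list nb + sum_list mt = sum_list lb + sum_list (rects k ts) + s"
    using sum munb by (simp add: sum_list_stack)
  with ge bound have eq: "sum_list mt = sum_list (rects k ts) + u" "sum_list nb + u = sum_list lb + s"
    by auto
  then have "rects k ts \<uplus> one_part u = mt"
    using bound mt by (intro part_union_eqI) (auto simp: bounded_partitions_iff)
  then have "mu = stack k ts nb u" using munb by (simp add: stack_def)
  moreover have "(nb, u) \<in> strips k lb s"
    using munb(2) rows hook ge by (auto simp: strips_def)
  ultimately show ?thesis using eq by blast
qed

end

section \<open>The Pieri rule over stacked rectangles\<close>

text \<open>The appended \<open>one_part u\<close> stands for row l + 1 of the core, the lowest row
  of the rectangles, after removal of the common S columns.\<close>

definition open_corners :: "nat list \<Rightarrow> nat list \<Rightarrow> nat \<Rightarrow> nat set" where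
  "open_corners lb nb u = {i \<in> {1..length lb}. part (nb @ one_part u) (Suc i) < part lb i}"

text \<open>Repeated widths count once, as in \<alpha>; for the rectangles of the theorem this is
  \<alpha> at u + 1.\<close>

definition wider :: "nat list \<Rightarrow> nat \<Rightarrow> nat" where
  "wider ts u = card {t \<in> set ts. u < t}"

lemma wider_Nil [simp]: "wider [] u = 0"
  by (simp add: wider_def)

context rect_stack
begin

text \<open>On the scale of \<open>res\<close> the open corners have labels part lb i + l - i in the
  rows of \<open>lb\<close> and t at the top of a rectangle of width t. These lie between 0 and k,
  and t < part lb i keeps the two kinds apart, so distinct residues are counted by adding the two
  cardinalities.\<close>

lemma r_number_stack:
  assumes "(nb, u) \<in> strips k lb r" "r \<le> k" "\<forall>x\<in>set lb. r \<le> x"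
  shows "r_number k (core_of k (stack k ts nb u)) (core_of k base) =
    card (open_corners lb nb u) + wider ts u"
proof -
  define K where "K = core_of k (stack k ts nb u)"
  define T where "T = core_of k base"
  note nb = stripsD [OF assms]
  note Ttop = part_base_core(1) [folded T_def] and Tbot = part_base_core(2) [folded T_def]
  note Kp = stack_props [OF assms, folded K_def T_def]
  let ?I = "{i. 1 \<le> i \<and> part K (Suc i) < part T i}"
  let ?I2 = "{i. 1 \<le> i \<and> part (rect_core k ts u) (Suc i) < part (rect_core k ts 0) i}"
  let ?O = "open_corners lb nb u"
  let ?f = "\<lambda>i. residue k (i, part T i)"
  let ?c = "\<lambda>i. part lb i + l - i"
  have K_Suc: "part K (Suc i) = S + part (nb @ one_part u) (Suc i)" if "1 \<le> i" "i \<le> l" for i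
  proof (cases "i = l")
    case True
    then show ?thesis using Kp(4) [of 1] nb(1) by (simp add: part_append part_one_part)
  next
    case False
    then show ?thesis using Kp(5) [of "Suc i"] nb(1) that by (simp add: part_append)
  qed
  have I: "?I = ?O \<union> (\<lambda>j. l + j) ` ?I2"
  proof (intro equalityI subsetI)
    fix i assume i: "i \<in> ?I"
    show "i \<in> ?O \<union> (\<lambda>j. l + j) ` ?I2"
    proof (cases "i \<le> l")
      case True
      then show ?thesis using i K_Suc [of i] Tbot [of i] by (auto simp: open_corners_def)
    next
      case False
      then obtain j where j: "i = l + j" "1 \<le> j"
        by (metis One_nat_def Suc_leI add.commute add_diff_cancel_left' le_add_diff_inverse2
            linorder_not_le nat_le_linear zero_less_diff)
      then have "j \<in> ?I2" using i Kp(4) [of "Suc j"] Ttop [of j] by auto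
      then show ?thesis using j by auto
    qed
  next
    fix i assume "i \<in> ?O \<union> (\<lambda>j. l + j) ` ?I2"
    then show "i \<in> ?I"
    proof
      assume "i \<in> ?O"
      then show ?thesis using K_Suc [of i] Tbot [of i] by (auto simp: open_corners_def)
    next
      assume "i \<in> (\<lambda>j. l + j) ` ?I2"
      then obtain j where "i = l + j" "j \<in> ?I2" by auto
      then show ?thesis using Kp(4) [of "Suc j"] Ttop [of j] by auto
    qed
  qed
  have O: "?f ` ?O = res ` ?c ` ?O"
    unfolding image_image
  proof (rule image_cong [OF refl])
    fix i assume "i \<in> ?O"
    then show "?f i = res (?c i)"
      using residue_row [of i "part lb i"] Tbot [of i] by (auto simp: open_corners_def)
  qed
  have top: "?f ` (\<lambda>j. l + j) ` ?I2 = res ` {t \<in> set ts. u < t}"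
  proof -
    have "\<exists>t\<in>set ts. u < t \<and> ?f (l + j) = res t" if "j \<in> ?I2" for j
    proof -
      have "residue k (j, part (rect_core k ts 0) j) \<in>
          (\<lambda>i. residue k (i, part (rect_core k ts 0) i)) ` ?I2"
        using that by blast
      then obtain t where "t \<in> set ts" "u < t"
        "residue k (j, part (rect_core k ts 0) j) = (int t + int S) mod (int k + 1)"
        unfolding rect_core_corners [OF widths] by auto
      then show ?thesis using residue_top Ttop [of j] that by auto
    qed
    moreover have "\<exists>j\<in>?I2. ?f (l + j) = res t" if "t \<in> set ts" "u < t" for t
    proof -
      have "(int t + int S) mod (int k + 1) \<in>
          (\<lambda>i. residue k (i, part (rect_core k ts 0) i)) ` ?I2"
        unfolding rect_core_corners [OF widths] using that by auto
      then obtain j where j: "j \<in> ?I2"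
        "residue k (j, part (rect_core k ts 0) j) = (int t + int S) mod (int k + 1)" by auto
      then have "?f (l + j) = res t" using residue_top Ttop [of j] by auto
      then show ?thesis using j by blast
    qed
    ultimately show ?thesis unfolding image_image by (fastforce simp: image_iff)
  qed
  have c_le: "?c i \<le> k" and c_ge: "part lb i \<le> ?c i" if "i \<in> ?O" for i
  proof -
    have "part lb i \<le> part lb 1" using that by (intro part_mono lb) (auto simp: open_corners_def)
    then show "?c i \<le> k" "part lb i \<le> ?c i"
      using that lb_hook by (auto simp: open_corners_def)
  qed
  have sub: "?c ` ?O \<union> {t \<in> set ts. u < t} \<subseteq> {0..k}"
    using c_le widths by (auto simp: widths_def)
  have fin: "finite ?O" by (simp add: open_corners_def)
  have "r_number k K T = card (?f ` ?I)"
  proof -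
    have "is_partition T" by (simp add: T_def base_bounded is_partition_core_of)
    moreover have "{(i, part T i) |i. 1 \<le> i \<and> part K (Suc i) < part T i} = (\<lambda>i. (i, part T i)) ` ?I"
      by auto
    ultimately show ?thesis using Kp(2) by (simp add: r_number_eq image_image)
  qed
  also have "?f ` ?I = res ` (?c ` ?O \<union> {t \<in> set ts. u < t})"
    unfolding I image_Un O top ..
  also have "card \<dots> = card (?c ` ?O \<union> {t \<in> set ts. u < t})"
    by (intro card_image inj_on_subset [OF inj_on_res sub])
  also have "\<dots> = card (?c ` ?O) + card {t \<in> set ts. u < t}"
  proof (rule card_Un_disjoint)
    show "?c ` ?O \<inter> {t \<in> set ts. u < t} = {}"
    proof (rule ccontr)
      assume "\<not> ?thesis"
      then obtain i where i: "i \<in> ?O" "?c i \<in> set ts" by auto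
      then have "part lb i \<in> set lb" by (intro part_in_set) (auto simp: open_corners_def)
      then show False using i ts_less c_ge [of i] by fastforce
    qed
  qed (use fin in auto)
  also have "card (?c ` ?O) = card ?O"
  proof (rule card_image, rule linorder_inj_onI)
    fix i j assume "i < j" "i \<in> ?O" "j \<in> ?O"
    then have "part lb j \<le> part lb i" "j \<le> l"
      by (auto simp: open_corners_def intro!: part_mono lb)
    then show "?c i \<noteq> ?c j" using \<open>i < j\<close> by simp
  qed auto
  finally show ?thesis by (simp add: K_def T_def wider_def)
qed

lemma finite_strips:
  assumes "r \<le> k" "\<forall>x\<in>set lb. r \<le> x"
  shows "finite (strips k lb r)"
proof (rule finite_subset)
  show "strips k lb r \<subseteq> {nb. set nb \<subseteq> {0..k} \<and> length nb = l} \<times> {0..r}"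
  proof
    fix z assume "z \<in> strips k lb r"
    then obtain nb u where z: "z = (nb, u)" "(nb, u) \<in> strips k lb r" by (cases z) auto
    note nb = stripsD [OF z(2) assms]
    have "part nb 1 \<le> k" using nb(1,3) by (cases nb) auto
    then have "nb \<in> bounded_partitions k" using nb(2) by (simp add: bounded_partitions_def)
    then show "z \<in> {nb. set nb \<subseteq> {0..k} \<and> length nb = l} \<times> {0..r}"
      using z nb by (auto simp: bounded_partitions_iff)
  qed
  show "finite ({nb. set nb \<subseteq> {0..k} \<and> length nb = l} \<times> {0..r})"
    by (intro finite_cartesian_product finite_lists_length_eq) auto
qed

lemma strips_mono: "s \<le> r \<Longrightarrow> strips k lb s \<subseteq> strips k lb r"
  by (auto simp: strips_def)

lemma weak_strips_eq:
  assumes "r \<le> k" "\<forall>x\<in>set lb. r \<le> x" "s \<le> r"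
  shows "{mu \<in> bounded_partitions k.
      weak_strip k s (bounded_to_core k mu) (bounded_to_core k base)} =
    (\<lambda>(nb, u). stack k ts nb u) ` {z \<in> strips k lb r. sum_list (fst z) + snd z - sum_list lb = s}"
    (is "?L = ?R")
proof (intro equalityI subsetI)
  fix mu assume "mu \<in> ?L"
  then have mu: "mu \<in> bounded_partitions k"
    and ws: "weak_strip k s (bounded_to_core k mu) (bounded_to_core k base)" by auto
  have s: "s \<le> k" "\<forall>x\<in>set lb. s \<le> x" using assms by auto
  obtain nb u where "(nb, u) \<in> strips k lb s" "mu = stack k ts nb u"
    "sum_list nb + u = sum_list lb + s"
    using strip_complete [OF mu s] ws [unfolded weak_strip_core_of_iff [OF mu base_bounded]] by blast
  then show "mu \<in> ?R" using strips_mono [OF assms(3)] by (auto intro!: image_eqI [of _ _ "(nb, u)"])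
next
  fix mu assume "mu \<in> ?R"
  then obtain nb u where mu: "mu = stack k ts nb u" "(nb, u) \<in> strips k lb r"
    "sum_list nb + u - sum_list lb = s" by auto
  then show "mu \<in> ?L"
    using stack_props [OF mu(2) assms(1,2)] stripsD [OF mu(2) assms(1,2)] base_bounded
    by (auto simp: weak_strip_core_of_iff sum_list_stack)
qed

lemma inj_on_stack: "inj_on (\<lambda>(nb, u). stack k ts nb u) (strips k lb r)"
proof (rule inj_onI, clarify)
  fix nb u nb' u'
  assume h: "(nb, u) \<in> strips k lb r" "(nb', u') \<in> strips k lb r" "stack k ts nb u = stack k ts nb' u'"
  then have "length nb = length nb'" by (auto simp: strips_def)
  with h(3) have "nb = nb'" by (auto simp: stack_def)
  moreover have "sum_list (stack k ts nb u) = sum_list (stack k ts nb' u')" using h(3) by simp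
  ultimately show "nb = nb' \<and> u = u'" by (simp add: sum_list_stack)
qed

end

lemma ibinom_of_nat: "ibinom (int a) b = int (a choose b)"
proof -
  have "real_of_int (ibinom (int a) b) = real_of_int (int (a choose b))"
    by (simp add: of_int_ibinom binomial_gbinomial)
  then show ?thesis by (simp only: of_int_eq_iff)
qed

context rect_stack
begin

text \<open>The sums over the strip sizes s are merged into one; the exponent is r - s with s = sum
  nb + u - sum lb.\<close>

lemma pieri_stack:
  assumes g: "K_k_Schur k g" and r: "r \<le> k" "\<forall>x\<in>set lb. r \<le> x"
  shows "hsym r * g base = (\<Sum>(nb, u)\<in>strips k lb r.
    (- 1) ^ (sum_list lb + r - (sum_list nb + u)) *
    of_nat ((card (open_corners lb nb u) + wider ts u) choose (sum_list lb + r - (sum_list nb + u))) *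
    g (stack k ts nb u))"
proof -
  let ?H = "strips k lb r"
  let ?e = "\<lambda>z :: nat list \<times> nat. sum_list (fst z) + snd z - sum_list lb"
  let ?q = "\<lambda>z. card (open_corners lb (fst z) (snd z)) + wider ts (snd z)"
  let ?g = "\<lambda>z. g (stack k ts (fst z) (snd z))"
  have "hsym r * g base = (\<Sum>s=0..r. (- 1) ^ (r - s) *
      (\<Sum>mu\<in>{mu \<in> bounded_partitions k.
          weak_strip k s (bounded_to_core k mu) (bounded_to_core k base)}.
        of_int (ibinom (int (r_number k (bounded_to_core k mu) (bounded_to_core k base))) (r - s)) * g mu))"
    using g r base_bounded unfolding K_k_Schur_def by blast
  also have "\<dots> = (\<Sum>s=0..r. \<Sum>z\<in>{z \<in> ?H. ?e z = s}.
      (- 1) ^ (r - ?e z) * of_nat (?q z choose (r - ?e z)) * ?g z)"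
  proof (rule sum.cong [OF refl])
    fix s assume "s \<in> {0..r}"
    then have s: "s \<le> r" by simp
    have inj: "inj_on (\<lambda>(nb, u). stack k ts nb u) {z \<in> ?H. ?e z = s}"
      by (rule inj_on_subset [OF inj_on_stack]) auto
    show "(- 1) ^ (r - s) *
      (\<Sum>mu\<in>{mu \<in> bounded_partitions k.
          weak_strip k s (bounded_to_core k mu) (bounded_to_core k base)}.
        of_int (ibinom (int (r_number k (bounded_to_core k mu) (bounded_to_core k base))) (r - s)) * g mu) =
      (\<Sum>z\<in>{z \<in> ?H. ?e z = s}. (- 1) ^ (r - ?e z) * of_nat (?q z choose (r - ?e z)) * ?g z)"
      unfolding weak_strips_eq [OF r s] sum.reindex [OF inj] sum_distrib_left
    proof (rule sum.cong [OF refl])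
      fix z assume z: "z \<in> {z \<in> ?H. ?e z = s}"
      obtain nb u where zz: "z = (nb, u)" by (cases z)
      with z have "(nb, u) \<in> ?H" by simp
      then have "bounded_to_core k (stack k ts nb u) = core_of k (stack k ts nb u)"
        "r_number k (core_of k (stack k ts nb u)) (core_of k base) = ?q z"
        using stack_props(1) r_number_stack r zz by (auto intro: bounded_to_core_eq)
      then show "(- 1) ^ (r - s) *
          ((\<lambda>mu. of_int (ibinom (int (r_number k (bounded_to_core k mu) (bounded_to_core k base))) (r - s)) * g mu) \<circ>
            (\<lambda>(nb, u). stack k ts nb u)) z =
          (- 1) ^ (r - ?e z) * of_nat (?q z choose (r - ?e z)) * ?g z"
        using z zz base_bounded
        by (simp add: bounded_to_core_eq ibinom_of_nat mult.assoc del: of_nat_add)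
    qed
  qed
  also have "\<dots> = (\<Sum>z\<in>?H. (- 1) ^ (r - ?e z) * of_nat (?q z choose (r - ?e z)) * ?g z)"
  proof (rule sum.group)
    show "?e ` ?H \<subseteq> {0..r}" by (auto simp: strips_def)
  qed (use finite_strips [OF r] in auto)
  also have "\<dots> = (\<Sum>(nb, u)\<in>?H.
    (- 1) ^ (sum_list lb + r - (sum_list nb + u)) *
    of_nat ((card (open_corners lb nb u) + wider ts u) choose (sum_list lb + r - (sum_list nb + u))) *
    g (stack k ts nb u))"
  proof (rule sum.cong [OF refl], clarify)
    fix nb u assume "(nb, u) \<in> ?H"
    then have "r - ?e (nb, u) = sum_list lb + r - (sum_list nb + u)"
      using stripsD(9) [of nb u r] r by auto
    then show "(- 1) ^ (r - ?e (nb, u)) * of_nat (?q (nb, u) choose (r - ?e (nb, u))) * ?g (nb, u) =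
      (- 1) ^ (sum_list lb + r - (sum_list nb + u)) *
      of_nat ((card (open_corners lb nb u) + wider ts u) choose (sum_list lb + r - (sum_list nb + u))) *
      g (stack k ts nb u)" by simp
  qed
  finally show ?thesis .
qed

end

section \<open>Products with unions of rectangles\<close>

lemma sum_triangle_shift:
  fixes f :: "nat \<Rightarrow> nat \<Rightarrow> 'a :: comm_monoid_add"
  shows "(\<Sum>u=0..R. \<Sum>s=0..u. f s (u - s)) = (\<Sum>w=0..R. \<Sum>s=0..R - w. f s w)"
proof -
  have "(\<Sum>u=0..R. \<Sum>s=0..u. f s (u - s)) = (\<Sum>(u, s)\<in>(SIGMA u:{0..R}. {0..u}). f s (u - s))"
    by (subst sum.Sigma) auto
  also have "\<dots> = (\<Sum>(w, s)\<in>(SIGMA w:{0..R}. {0..R - w}). f s w)"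
    by (rule sum.reindex_bij_witness
        [where i = "\<lambda>(w, s). (w + s, s)" and j = "\<lambda>(u, s). (u - s, s)"]) auto
  also have "\<dots> = (\<Sum>w=0..R. \<Sum>s=0..R - w. f s w)"
    by (subst sum.Sigma) auto
  finally show ?thesis .
qed

text \<open>For \<open>u = R\<close> the binomial coefficient involving \<open>q u\<close> is \<open>1\<close>, so the value \<open>q R\<close> plays no role.\<close>

lemma vandermonde_strip_sum:
  fixes G :: "nat \<Rightarrow> 'a :: comm_ring_1"
  assumes q: "\<And>u. u < R \<Longrightarrow> q u = q0"
  shows "(\<Sum>u=0..R. (- 1) ^ (R - u) * of_nat (q u choose (R - u)) *
      (\<Sum>s=0..u. (- 1) ^ s * of_nat (A (u - s) choose s) * G (u - s))) =
    (\<Sum>u=0..R. (- 1) ^ (R - u) * of_nat ((q u + A u) choose (R - u)) * G u)"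
proof -
  have q0: "q u choose (R - u) = q0 choose (R - u)" "(q u + A u) choose (R - u) = (q0 + A u) choose (R - u)"
    if "u \<le> R" for u
    using that q [of u] by (cases "u = R"; simp)+
  let ?f = "\<lambda>s w. (- 1) ^ (R - w) * of_nat ((A w choose s) * (q0 choose (R - w - s))) * G w"
  have "(\<Sum>u=0..R. (- 1) ^ (R - u) * of_nat (q u choose (R - u)) *
      (\<Sum>s=0..u. (- 1) ^ s * of_nat (A (u - s) choose s) * G (u - s))) =
    (\<Sum>u=0..R. \<Sum>s=0..u. ?f s (u - s))"
    unfolding sum_distrib_left
  proof (intro sum.cong refl)
    fix u s assume "u \<in> {0..R}" "s \<in> {0..u}"
    then have us: "s \<le> u" "u \<le> R" by auto
    then have "(- 1 :: 'a) ^ (R - (u - s)) = (- 1) ^ (R - u) * (- 1) ^ s" "R - (u - s) - s = R - u"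
      by (auto simp flip: power_add)
    then show "(- 1) ^ (R - u) * of_nat (q u choose (R - u)) *
        ((- 1) ^ s * of_nat (A (u - s) choose s) * G (u - s)) = ?f s (u - s)"
      using q0(1) [OF us(2)] by (simp add: algebra_simps)
  qed
  also have "\<dots> = (\<Sum>w=0..R. \<Sum>s=0..R - w. ?f s w)"
    by (rule sum_triangle_shift)
  also have "\<dots> = (\<Sum>w=0..R. (- 1) ^ (R - w) * of_nat ((q w + A w) choose (R - w)) * G w)"
  proof (rule sum.cong [OF refl])
    fix w assume "w \<in> {0..R}"
    have "(\<Sum>s=0..R - w. ?f s w) =
        (- 1) ^ (R - w) * of_nat (\<Sum>s=0..R - w. (A w choose s) * (q0 choose (R - w - s))) * G w"
      by (simp only: of_nat_sum sum_distrib_left sum_distrib_right)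
    also have "(\<Sum>s=0..R - w. (A w choose s) * (q0 choose (R - w - s))) = (q0 + A w) choose (R - w)"
      using vandermonde [of "A w" q0 "R - w"] by (simp add: atLeast0AtMost add.commute)
    finally show "(\<Sum>s=0..R - w. ?f s w) = (- 1) ^ (R - w) * of_nat ((q w + A w) choose (R - w)) * G w"
      using q0(2) [of w] \<open>w \<in> {0..R}\<close> by simp
  qed
  finally show ?thesis .
qed

context rect_stack
begin

lemma rect_stack_strip:
  assumes "(nb, u) \<in> strips k lb r" "r \<le> k" "\<forall>x\<in>set lb. r \<le> x"
  shows "rect_stack k ts nb"
  using stripsD [OF assms] widths by unfold_locales auto

lemma rect_stack_Nil: "rect_stack k [] lb"
  using lb lb_hook by unfold_locales auto

lemma strip_eq_top:
  assumes "(nb, r) \<in> strips k lb r" "r \<le> k" "\<forall>x\<in>set lb. r \<le> x"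
  shows "nb = lb"
proof -
  note nb = stripsD [OF assms]
  have eq: "sum_list nb = sum_list lb" using nb(8,9) by simp
  have "part nb i = part lb i" if "1 \<le> i" "i \<le> l" for i
  proof (rule ccontr)
    assume "part nb i \<noteq> part lb i"
    then have "(\<Sum>i\<in>{1..l}. part lb i) < (\<Sum>i\<in>{1..l}. part nb i)"
      using that nb(10) by (intro sum_strict_mono_ex1) (auto intro!: bexI [of _ i] simp: le_neq_implies_less)
    then show False using eq nb(1) by (simp add: sum_list_part)
  qed
  then show ?thesis
    using nb(1,2) lb part_eq_0 [of nb] part_eq_0 [of lb]
    by (intro partition_eqI) (auto simp: not_le [symmetric], metis)
qed

lemma strips_eq_Sigma:
  "strips k lb r = (SIGMA nb:fst ` strips k lb r. {0..sum_list lb + r - sum_list nb})"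
proof -
  have "(nb, u) \<in> strips k lb r \<longleftrightarrow>
      nb \<in> fst ` strips k lb r \<and> u \<le> sum_list lb + r - sum_list nb" for nb u
    by (auto simp: strips_def image_iff)
  then show ?thesis by auto
qed

text \<open>Read with A = \<open>wider ts\<close>: inserting the claimed product formula into the
  rule over \<open>lb\<close> produces the rule over the rectangles with \<open>lb\<close>. This
  holds for each \<open>nb\<close> separately, by \<open>vandermonde_strip_sum\<close>.\<close>

lemma sum_strips_inversion:
  fixes G :: "nat list \<Rightarrow> nat \<Rightarrow> 'a :: comm_ring_1"
  assumes r: "r \<le> k" "\<forall>x\<in>set lb. r \<le> x"
  shows "(\<Sum>(nb, u)\<in>strips k lb r.
      (- 1) ^ (sum_list lb + r - (sum_list nb + u)) *
      of_nat (card (open_corners lb nb u) choose (sum_list lb + r - (sum_list nb + u))) *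
      (\<Sum>s=0..u. (- 1) ^ s * of_nat (A (u - s) choose s) * G nb (u - s))) =
    (\<Sum>(nb, u)\<in>strips k lb r.
      (- 1) ^ (sum_list lb + r - (sum_list nb + u)) *
      of_nat ((card (open_corners lb nb u) + A u) choose (sum_list lb + r - (sum_list nb + u))) * G nb u)"
proof -
  let ?N = "fst ` strips k lb r"
  let ?R = "\<lambda>nb. sum_list lb + r - sum_list nb"
  have fin: "finite ?N" using finite_strips [OF r] by simp
  have split: "(\<Sum>(nb, u)\<in>strips k lb r. h nb u) = (\<Sum>nb\<in>?N. \<Sum>u=0..?R nb. h nb u)"
    for h :: "nat list \<Rightarrow> nat \<Rightarrow> 'a"
    by (subst strips_eq_Sigma, subst sum.Sigma [symmetric]) (use fin in auto)
  show ?thesis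
    unfolding split diff_diff_left [symmetric]
  proof (rule sum.cong [OF refl], rule vandermonde_strip_sum)
    fix nb u assume nb: "nb \<in> ?N" and u: "u < ?R nb"
    then obtain u' where "(nb, u') \<in> strips k lb r" by auto
    note nb = stripsD [OF this r]
    \<comment> \<open>Below its maximal value u is smaller than r, hence than the last part of
      \<open>lb\<close>, so the corner in row l stays unblocked whatever u is.\<close>
    have less: "u < part lb i" if "1 \<le> i" "i \<le> l" for i
      using u nb(9) r(2) part_in_set [of i lb] that by fastforce
    have "part (nb @ one_part u) (Suc i) < part lb i \<longleftrightarrow> part (nb @ one_part 0) (Suc i) < part lb i"
      if i: "1 \<le> i" "i \<le> l" for i
    proof (cases "i = l")
      case True
      then show ?thesis using less [OF i] nb(1) by (simp add: part_append part_one_part part_eq_0)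
    next
      case False
      then show ?thesis using i nb(1) by (simp add: part_append)
    qed
    then have "open_corners lb nb u = open_corners lb nb 0"
      by (auto simp: open_corners_def)
    then show "card (open_corners lb nb u) = card (open_corners lb nb 0)" by simp
  qed
qed

end

section \<open>The product formula by induction on rows and on r\<close>

lemma wider_diff:
  assumes "w \<le> v"
  shows "wider ts v \<le> wider ts w" "wider ts w \<le> wider ts v + (v - w)"
proof -
  show "wider ts v \<le> wider ts w"
    unfolding wider_def using assms by (intro card_mono) auto
  have "card {t \<in> set ts. w < t} \<le> card ({t \<in> set ts. v < t} \<union> {w<..v})"
    by (intro card_mono) auto
  also have "\<dots> \<le> card {t \<in> set ts. v < t} + card {w<..v}" by (rule card_Un_le)
  finally show "wider ts w \<le> wider ts v + (v - w)" by (simp add: wider_def)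
qed

text \<open>Since x exceeds all widths, inserting it among the rectangles puts it below them. A last
  row of \<open>lb\<close> can thus be traded for an inserted part, which is how the outer induction
  loses a row.\<close>

lemma rect_stack_butlast:
  assumes "rect_stack k ts (lb @ [x])"
  shows "rect_stack k ts lb" "x \<le> k" "\<forall>y\<in>set lb. x \<le> y"
    and "stack k ts lb x = stack k ts (lb @ [x]) 0"
proof -
  interpret rect_stack k ts "lb @ [x]" by fact
  have p: "is_partition lb" "0 < x" "\<forall>y\<in>set lb. x \<le> y"
    using lb by (auto simp: is_partition_append is_partition_Cons)
  then show "\<forall>y\<in>set lb. x \<le> y" by simp
  show "rect_stack k ts lb"
  proof
    show "part lb 1 + length lb \<le> Suc k"
      using lb_hook by (cases lb) (auto simp: part_append)
  qed (use p widths ts_less in auto)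
  show "x \<le> k" using lb_le [of "Suc (length lb)"] by (simp add: part_append)
  have ts: "\<forall>t\<in>set ts. t < x" using ts_less by simp
  have "rects k ts \<uplus> one_part x = x # rects k ts"
    using p is_partition_rects [OF widths] ts set_rects_subset [of k ts]
    by (intro part_union_eqI) (auto simp: is_partition_Cons one_part_def intro: less_imp_le)
  then show "stack k ts lb x = stack k ts (lb @ [x]) 0"
    using is_partition_rects [OF widths] by (simp add: stack_def)
qed

lemma stack_Nil: "stack k [] nb u = nb @ one_part u"
proof -
  have "[] \<uplus> one_part u = one_part u" by (rule part_union_eqI) auto
  then show ?thesis by (simp add: stack_def)
qed

text \<open>Multiplying the rule over \<open>lb\<close> by the function of the rectangles and
  comparing it with the rule over \<open>base\<close> gives one linear relation between the defects
  of the formula. Defects with u < r vanish by the inner induction, and (lb, r) is the only strip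
  with u = r; its coefficient is 1. The case r = 0 comes from the formula with one row
  fewer.\<close>

lemma rects_mult_stack:
  assumes g: "K_k_Schur k g"
    and "rect_stack k ts lb" "r \<le> k" "\<forall>x\<in>set lb. r \<le> x"
  shows "g (rects k ts) * g (lb @ one_part r) =
    (\<Sum>s=0..r. (- 1) ^ s * of_nat (wider ts (r - s) choose s) * g (stack k ts lb (r - s)))"
  using assms(2-)
proof (induction "length lb" arbitrary: lb r rule: less_induct)
  case (less lb r)
  note outer = less.hyps
  have base: "g (rects k ts) * g lb' = g (stack k ts lb' 0)"
    if rs: "rect_stack k ts lb'" "length lb' = length lb" for lb'
  proof (cases lb' rule: rev_cases)
    case Nil
    then show ?thesis
      using g is_partition_rects [OF rect_stack.widths [OF rs(1)]] by (simp add: K_k_Schur_def stack_def)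
  next
    case (snoc lb1 x)
    note b = rect_stack_butlast [of k ts lb1 x]
    have rs1: "rect_stack k ts (lb1 @ [x])" using rs snoc by simp
    have "x \<noteq> 0" using rect_stack.lb [OF rs1] by (auto simp: is_partition_def)
    have "g (rects k ts) * g (lb1 @ one_part x) =
        (\<Sum>s=0..x. (- 1) ^ s * of_nat (wider ts (x - s) choose s) * g (stack k ts lb1 (x - s)))"
      using b [OF rs1] snoc rs(2) by (intro outer) auto
    also have "\<dots> = (\<Sum>s\<in>{0}. (- 1) ^ s * of_nat (wider ts (x - s) choose s) * g (stack k ts lb1 (x - s)))"
    proof (rule sum.mono_neutral_right)
      show "\<forall>s\<in>{0..x} - {0}. (- 1) ^ s * of_nat (wider ts (x - s) choose s) * g (stack k ts lb1 (x - s)) = 0"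
      proof
        fix s assume "s \<in> {0..x} - {0}"
        then have s: "1 \<le> s" "s \<le> x" by auto
        \<comment> \<open>All widths are below x, so at most s - 1 distinct ones exceed x - s and
          the binomial coefficient vanishes.\<close>
        have "wider ts (x - s) \<le> wider ts (x - 1) + (s - 1)"
          using wider_diff(2) [of "x - s" "x - 1" ts] s by simp
        moreover have "wider ts (x - 1) = 0"
        proof -
          have "{t \<in> set ts. x - 1 < t} = {}"
            using rect_stack.ts_less [OF rs1] by (auto simp: not_less)
          then show ?thesis by (simp add: wider_def)
        qed
        ultimately have "wider ts (x - s) < s" using s by simp
        then show "(- 1) ^ s * of_nat (wider ts (x - s) choose s) * g (stack k ts lb1 (x - s)) = 0"
          by (simp add: binomial_eq_0)
      qed
    qed auto
    finally show ?thesis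
      using b(4) [OF rs1] snoc \<open>x \<noteq> 0\<close> by (simp add: one_part_def)
  qed
  \<comment> \<open>The row number n is fixed and \<open>lb\<close> varies, because the strips over
    \<open>lb\<close> lead to other partitions \<open>nb\<close> of the same length.\<close>
  have "g (rects k ts) * g (lb @ one_part r) =
      (\<Sum>s=0..r. (- 1) ^ s * of_nat (wider ts (r - s) choose s) * g (stack k ts lb (r - s)))"
    if "length lb = n" "rect_stack k ts lb" "r \<le> k" "\<forall>x\<in>set lb. r \<le> x"
      "\<And>lb'. rect_stack k ts lb' \<Longrightarrow> length lb' = n \<Longrightarrow> g (rects k ts) * g lb' = g (stack k ts lb' 0)"
    for lb r n
    using that(1-4)
  proof (induction r arbitrary: lb rule: less_induct)
    case (less r lb)
    show ?case
    proof (cases "r = 0")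
      case True
      then show ?thesis using that(5) [of lb] less.prems by (simp add: one_part_def)
    next
      case False
      interpret rect_stack k ts lb by (rule less.prems)
      interpret E: rect_stack k "[]" lb by (rule rect_stack_Nil)
      note r = less.prems(3,4)
      let ?H = "strips k lb r"
      let ?e = "\<lambda>nb u. sum_list lb + r - (sum_list nb + u)"
      let ?c = "\<lambda>nb u. (- 1) ^ ?e nb u * of_nat (card (open_corners lb nb u) choose ?e nb u) :: mfps"
      let ?d = "\<lambda>nb u. (- 1) ^ ?e nb u * of_nat ((card (open_corners lb nb u) + wider ts u) choose ?e nb u) :: mfps"
      let ?F = "\<lambda>nb u. \<Sum>s=0..u. (- 1) ^ s * of_nat (wider ts (u - s) choose s) * g (stack k ts nb (u - s))"
      let ?X = "\<lambda>nb u. g (rects k ts) * g (nb @ one_part u) - ?F nb u"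
      have E_base: "stack k [] lb 0 = lb" by (simp add: stack_Nil)
      have "hsym r * g lb = (\<Sum>(nb, u)\<in>?H. ?c nb u * g (nb @ one_part u))"
        using E.pieri_stack [OF g r] by (simp add: E_base stack_Nil)
      then have "g (rects k ts) * (hsym r * g lb) = (\<Sum>(nb, u)\<in>?H. ?c nb u * (g (rects k ts) * g (nb @ one_part u)))"
        by (simp add: sum_distrib_left case_prod_unfold mult_ac)
      moreover have "g (rects k ts) * (hsym r * g lb) = hsym r * g base"
        using that(5) [of lb] less.prems by (simp add: mult_ac)
      moreover have "hsym r * g base = (\<Sum>(nb, u)\<in>?H. ?d nb u * g (stack k ts nb u))"
        by (rule pieri_stack [OF g r])
      moreover have "(\<Sum>(nb, u)\<in>?H. ?c nb u * ?F nb u) = (\<Sum>(nb, u)\<in>?H. ?d nb u * g (stack k ts nb u))"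
        by (rule sum_strips_inversion [OF r, where G = "\<lambda>nb u. g (stack k ts nb u)"])
      ultimately have "(\<Sum>(nb, u)\<in>?H. ?c nb u * ?X nb u) = 0"
        by (simp add: right_diff_distrib case_prod_unfold sum_subtractf)
      moreover have "(\<Sum>(nb, u)\<in>?H. ?c nb u * ?X nb u) = (\<Sum>(nb, u)\<in>{(lb, r)}. ?c nb u * ?X nb u)"
      proof (rule sum.mono_neutral_right)
        show "{(lb, r)} \<subseteq> ?H"
        proof -
          have "part lb (Suc i) \<le> part lb i" if "1 \<le> i" for i
            using that by (intro part_mono lb) auto
          then show ?thesis using lb_hook by (auto simp: strips_def)
        qed
        show "\<forall>z\<in>?H - {(lb, r)}. (case z of (nb, u) \<Rightarrow> ?c nb u * ?X nb u) = 0"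
        proof
          fix z assume "z \<in> ?H - {(lb, r)}"
          then obtain nb u where z: "z = (nb, u)" "(nb, u) \<in> ?H" "(nb, u) \<noteq> (lb, r)"
            by (cases z) auto
          note nb = stripsD [OF z(2) r]
          have "u \<noteq> r" using strip_eq_top [OF _ r, of nb] z by auto
          then have "?X nb u = 0"
            using less.IH [of u nb] rect_stack_strip [OF z(2) r] nb less.prems(1) by simp
          then show "(case z of (nb, u) \<Rightarrow> ?c nb u * ?X nb u) = 0" using z(1) by simp
        qed
      qed (rule finite_strips [OF r])
      ultimately have "?X lb r = 0" by simp
      then show ?thesis by simp
    qed
  qed
  from this [OF refl less.prems base] show ?case .
qed

section \<open>Inversion of the product formula\<close>

text \<open>Up to notation, the coefficient of x^n in (1 - x)^(-c) * (1 - x)^d = (1 - x)^(d - c), a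
  polynomial of degree d - c < n.\<close>

lemma inverse_binomial_sum:
  assumes "c \<le> d" "d < c + n"
  shows "(\<Sum>j=0..n. ibinom (int c + int (n - j) - 1) (n - j) * ((- 1) ^ j * int (d choose j))) = 0"
proof -
  have b: "real_of_int (ibinom (int c + int m - 1) m) = (- 1) ^ m * ((- real c) gchoose m)" for m
    using gbinomial_minus [of "real c" m] by (simp add: of_int_ibinom flip: power_add mult.assoc)
  have "real_of_int (\<Sum>j=0..n. ibinom (int c + int (n - j) - 1) (n - j) * ((- 1) ^ j * int (d choose j))) =
      (\<Sum>j=0..n. (- 1) ^ n * ((real d gchoose j) * ((- real c) gchoose (n - j))))"
    unfolding of_int_sum
  proof (rule sum.cong [OF refl])
    fix j assume "j \<in> {0..n}"
    then have "(- 1 :: real) ^ n = (- 1) ^ (n - j) * (- 1) ^ j" by (simp flip: power_add)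
    then show "real_of_int (ibinom (int c + int (n - j) - 1) (n - j) * ((- 1) ^ j * int (d choose j))) =
        (- 1) ^ n * ((real d gchoose j) * ((- real c) gchoose (n - j)))"
      by (simp only: of_int_mult b) (simp add: binomial_gbinomial)
  qed
  also have "\<dots> = (- 1) ^ n * ((real d + - real c) gchoose n)"
    by (simp only: sum_distrib_left [symmetric] gbinomial_Vandermonde)
  also have "real d + - real c = real (d - c)" using assms(1) by simp
  also have "real (d - c) gchoose n = real ((d - c) choose n)" by (simp add: binomial_gbinomial)
  also have "(d - c) choose n = 0" using assms by (intro binomial_eq_0) simp
  finally show ?thesis by (simp only: of_int_eq_0_iff of_nat_0 mult_zero_right)
qed

text \<open>After substitution of the product formula, the coefficient of the function at
  \<open>stack k ts lb w\<close> is the preceding sum with n = r - w and d =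
  \<open>wider ts w\<close>. For w < r, d - c counts the widths above w and below r, of which there
  are fewer than n; so only w = r survives.\<close>

lemma stack_eq_rects_mult:
  assumes g: "K_k_Schur k g"
    and rs: "rect_stack k ts lb" "r \<le> k" "\<forall>x\<in>set lb. r \<le> x"
    and c: "c = card {t \<in> set ts. r \<le> t}"
  shows "g (stack k ts lb r) = g (rects k ts) *
    (\<Sum>s=0..r. of_int (ibinom (int c + int s - 1) s) * g (lb @ one_part (r - s)))"
proof -
  let ?b = "\<lambda>s. of_int (ibinom (int c + int s - 1) s) :: mfps"
  let ?G = "\<lambda>w. g (stack k ts lb w)"
  let ?f = "\<lambda>j w. ?b (r - (w + j)) * ((- 1) ^ j * of_nat (wider ts w choose j) * ?G w)"
  have "g (rects k ts) * (\<Sum>s=0..r. ?b s * g (lb @ one_part (r - s))) =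
      (\<Sum>s=0..r. ?b s * (g (rects k ts) * g (lb @ one_part (r - s))))"
    by (simp add: sum_distrib_left mult_ac)
  also have "\<dots> = (\<Sum>u=0..r. ?b (r - u) * (g (rects k ts) * g (lb @ one_part u)))"
    by (rule sum.reindex_bij_witness [where i = "\<lambda>u. r - u" and j = "\<lambda>u. r - u"]) auto
  also have "\<dots> = (\<Sum>u=0..r. \<Sum>j=0..u. ?f j (u - j))"
  proof (rule sum.cong [OF refl])
    fix u assume "u \<in> {0..r}"
    then have "g (rects k ts) * g (lb @ one_part u) =
        (\<Sum>j=0..u. (- 1) ^ j * of_nat (wider ts (u - j) choose j) * ?G (u - j))"
      using rs by (intro rects_mult_stack [OF g]) auto
    then show "?b (r - u) * (g (rects k ts) * g (lb @ one_part u)) = (\<Sum>j=0..u. ?f j (u - j))"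
      by (simp add: sum_distrib_left)
  qed
  also have "\<dots> = (\<Sum>w=0..r. \<Sum>j=0..r - w. ?f j w)" by (rule sum_triangle_shift)
  also have "\<dots> = (\<Sum>w\<in>{r}. \<Sum>j=0..r - w. ?f j w)"
  proof (rule sum.mono_neutral_right)
    show "\<forall>w\<in>{0..r} - {r}. (\<Sum>j=0..r - w. ?f j w) = 0"
    proof
      fix w assume "w \<in> {0..r} - {r}"
      then have w: "w < r" by auto
      have "{t \<in> set ts. r \<le> t} = {t \<in> set ts. r - 1 < t}" using w by auto
      then have "c = wider ts (r - 1)" by (simp add: c wider_def)
      moreover have "w \<le> r - 1" "r - 1 - w < r - w" using w by auto
      ultimately have cw: "c \<le> wider ts w" "wider ts w < c + (r - w)"
        using wider_diff [of w "r - 1" ts] by linarith+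
      have "(\<Sum>j=0..r - w. ?f j w) = of_int (\<Sum>j=0..r - w. ibinom (int c + int (r - w - j) - 1) (r - w - j) *
          ((- 1) ^ j * int (wider ts w choose j))) * ?G w"
        by (simp add: sum_distrib_left mult_ac)
      then show "(\<Sum>j=0..r - w. ?f j w) = 0" by (simp only: inverse_binomial_sum [OF cw]) simp
    qed
  qed auto
  finally show ?thesis by (simp add: ibinom_def)
qed

section \<open>From the data of the theorem to a list of widths\<close>

lemma is_partition_rect_power: "is_partition (rect_power k t a)"
  unfolding rect_power_def
  by (induction a) (auto intro!: is_partition_part_union simp: rect_def is_partition_replicate)

lemma mset_rect_power: "mset (rect_power k t a) = mset (concat (replicate a (rect k t)))"
  unfolding rect_power_def by (induction a) auto

lemma foldr_part_union:
  assumes "\<And>x. x \<in> set xs \<Longrightarrow> is_partition (f x)"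
  shows "is_partition (foldr (\<uplus>) (map f xs) []) \<and>
    mset (foldr (\<uplus>) (map f xs) []) = mset (concat (map f xs))"
  using assms by (induction xs) (auto intro: is_partition_part_union)

lemma mset_concat_map_cong: "mset xs = mset ys \<Longrightarrow> mset (concat (map f xs)) = mset (concat (map f ys))"
  by (simp add: mset_concat flip: sum_mset_sum_list)

text \<open>The list contains each t v with multiplicity a v, in decreasing order; its set forgets
  the multiplicities.\<close>

lemma rect_union_eq_rects:
  fixes t a :: "nat \<Rightarrow> nat"
  assumes t: "\<forall>v\<in>{1..m}. 1 \<le> t v \<and> t v \<le> k" and a: "\<forall>v\<in>{1..m}. 1 \<le> a v"
  shows "\<exists>ts. widths k ts \<and> set ts = t ` {1..m} \<and> rect_union k m t a = rects k ts"
proof -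
  define us where "us = concat (map (\<lambda>v. replicate (a v) (t v)) [1..<m + 1])"
  define ts where "ts = rev (sort us)"
  have set: "set ts = t ` {1..m}"
    using a by (fastforce simp: ts_def us_def image_iff)
  have w: "widths k ts"
    using t set by (auto simp: widths_def is_partition_def ts_def sorted_wrt_rev)
  have "mset (concat (map (\<lambda>v. rect_power k (t v) (a v)) vs)) =
      mset (concat (map (rect k) (concat (map (\<lambda>v. replicate (a v) (t v)) vs))))" for vs
    by (induction vs) (auto simp: mset_rect_power)
  then have "mset (rect_union k m t a) = mset (rects k ts)"
    using foldr_part_union [of "[1..<m + 1]" "\<lambda>v. rect_power k (t v) (a v)"]
      is_partition_rect_power mset_concat_map_cong [of us ts "rect k"]
    by (simp add: rect_union_def rects_def us_def ts_def del: upt_Suc)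
  moreover have "is_partition (rect_union k m t a)"
    using foldr_part_union [of "[1..<m + 1]" "\<lambda>v. rect_power k (t v) (a v)"] is_partition_rect_power
    by (simp add: rect_union_def)
  moreover have "is_partition (rects k ts)" by (rule is_partition_rects [OF w])
  ultimately have "rect_union k m t a = rects k ts"
    using part_union_eqI [of "rects k ts" "rect_union k m t a" "[]"] by simp
  then show ?thesis using w set by blast
qed

theorem theorem5p7:
  fixes k m r lbar :: nat and t a :: "nat \<Rightarrow> nat"
    and la labar P :: "nat list" and g :: "nat list \<Rightarrow> mfps"
  assumes "k \<ge> 1" and "m \<ge> 1"
    and "K_k_Schur k g"
    and "\<forall>v\<in>{1..m}. 1 \<le> t v \<and> t v \<le> k"
    and "inj_on t {1..m}"
    and "\<forall>v\<in>{1..m}. a v \<ge> 1"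
    and "P = rect_union k m t a"
    and "la \<in> bounded_partitions k" and "la \<noteq> []"
    and "labar = butlast la" and "lbar = length la - 1"
    and "diagram labar \<subseteq> diagram (rect k (k + 1 - lbar))"
    and "r = part la (length la)"
    and "lbar \<ge> 1 \<longrightarrow> Max (t ` {1..m}) < part labar lbar"
  shows "g P * g la =
           (\<Sum>s=0..r. (- 1) ^ s * of_int (ibinom (int (alpha m t (r + 1 - s))) s) *
              g (P \<uplus> labar \<uplus> one_part (r - s)))
       \<and> g (P \<uplus> la) =
           g P * (\<Sum>s=0..r. of_int (ibinom (int (alpha m t r) + int s - 1) s) *
              g (labar \<uplus> one_part (r - s)))
       \<and> (Max (t ` {1..m}) < r \<longrightarrow> g (P \<uplus> la) = g P * g la)"
proof -
  obtain ts where ts: "widths k ts" "set ts = t ` {1..m}" "P = rects k ts"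
    using rect_union_eq_rects [OF assms(4,6)] assms(7) by auto
  have la: "la = labar @ [r]"
    using assms(9,10,13) by (cases la rule: rev_cases) (auto simp: part_append)
  have lbar: "lbar = length labar" using la assms(11) by simp
  have p: "is_partition labar" "0 < r" "\<forall>x\<in>set labar. r \<le> x" "r \<le> k"
    using assms(8) la by (auto simp: bounded_partitions_iff is_partition_append is_partition_Cons)
  \<comment> \<open>The first row of the rectangle in the containment hypothesis has length k + 1 -
    lbar.\<close>
  have hook: "part labar 1 + length labar \<le> Suc k"
  proof (cases "labar = []")
    case False
    then have "0 < part labar 1" "1 \<le> lbar"
      using p(1) lbar by (auto intro!: part_pos simp: Suc_le_eq)
    then have "(1, part labar 1) \<in> diagram labar" by (simp add: mem_diagram)
    then have "(1, part labar 1) \<in> diagram (rect k (k + 1 - lbar))"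
      using assms(12) by blast
    then show ?thesis
      using \<open>0 < part labar 1\<close> lbar
      by (auto simp: mem_diagram rect_def part_replicate split: if_splits)
  qed simp
  have "t' < x" if tx: "t' \<in> set ts" "x \<in> set labar" for t' x
  proof -
    obtain i where i: "i < length labar" "x = part labar (Suc i)"
      using tx(2) by (metis in_set_conv_nth part_Suc)
    then have "part labar lbar \<le> x" using part_mono [OF p(1), of "Suc i" lbar] lbar by simp
    moreover have "t' \<le> Max (t ` {1..m})" using tx(1) ts(2) by (intro Max_ge) auto
    ultimately show ?thesis using assms(14) i lbar by auto
  qed
  then have rs: "rect_stack k ts labar"
    using ts p hook by unfold_locales auto
  have stack: "P \<uplus> labar \<uplus> one_part w = stack k ts labar w" if "w \<le> r" for w
  proof (rule part_union_eqI)
    have "is_partition (rects k ts \<uplus> one_part w)"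
      by (intro is_partition_part_union is_partition_rects ts) simp
    moreover have "y \<le> x" if "x \<in> set labar" "y \<in> set (rects k ts \<uplus> one_part w)" for x y
      using that \<open>w \<le> r\<close> p(3) set_one_part_le [of y w] set_rects_subset [of k ts]
        rect_stack.ts_less [OF rs] by (fastforce intro: less_imp_le)
    ultimately show "is_partition (stack k ts labar w)"
      using p(1) by (auto simp: stack_def is_partition_append)
  qed (simp add: stack_def ts(3))
  have bottom: "labar \<uplus> one_part w = labar @ one_part w" if "w \<le> r" for w
    using p that by (intro part_union_eqI) (fastforce simp: is_partition_append dest: set_one_part_le)+
  have one_r: "one_part r = [r]" using p(2) by (simp add: one_part_def)
  have P_la: "P \<uplus> la = stack k ts labar r"
  proof (rule part_union_eqI)
    have "is_partition (P \<uplus> labar \<uplus> one_part r)"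
      using p ts by (simp add: is_partition_part_union is_partition_rects)
    then show "is_partition (stack k ts labar r)" using stack [of r] by simp
  qed (simp add: stack_def ts(3) la one_r)
  \<comment> \<open>Distinctness of the t v turns the count of indices in \<open>alpha\<close> into
    a count of widths.\<close>
  have card_t: "card {x \<in> set ts. Q x} = card {v. 1 \<le> v \<and> v \<le> m \<and> Q (t v)}" for Q
  proof -
    have "{x \<in> set ts. Q x} = t ` {v. 1 \<le> v \<and> v \<le> m \<and> Q (t v)}" using ts(2) by auto
    moreover have "inj_on t {v. 1 \<le> v \<and> v \<le> m \<and> Q (t v)}"
      by (rule inj_on_subset [OF assms(5)]) auto
    ultimately show ?thesis by (simp add: card_image)
  qed
  have alpha: "alpha m t u = card {x \<in> set ts. u \<le> x}" for u
    unfolding card_t alpha_def ..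
  have wider: "wider ts u = alpha m t (u + 1)" for u
    by (simp add: alpha wider_def Suc_le_eq)
  have 1: "g P * g la =
           (\<Sum>s=0..r. (- 1) ^ s * of_int (ibinom (int (alpha m t (r + 1 - s))) s) *
              g (P \<uplus> labar \<uplus> one_part (r - s)))"
  proof -
    have "g P * g la = (\<Sum>s=0..r. (- 1) ^ s * of_nat (wider ts (r - s) choose s) * g (stack k ts labar (r - s)))"
      using rects_mult_stack [OF assms(3) rs p(4,3)] by (simp add: ts(3) la one_r)
    also have "\<dots> = (\<Sum>s=0..r. (- 1) ^ s * of_int (ibinom (int (alpha m t (r + 1 - s))) s) *
              g (P \<uplus> labar \<uplus> one_part (r - s)))"
      by (intro sum.cong refl) (simp add: wider stack ibinom_of_nat Suc_diff_le)
    finally show ?thesis .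
  qed
  have 2: "g (P \<uplus> la) = g P * (\<Sum>s=0..r. of_int (ibinom (int (alpha m t r) + int s - 1) s) *
              g (labar \<uplus> one_part (r - s)))"
    unfolding P_la using stack_eq_rects_mult [OF assms(3) rs p(4,3) alpha]
    by (simp add: ts(3) bottom)
  have "g (P \<uplus> la) = g P * g la" if "Max (t ` {1..m}) < r"
  proof -
    have "x < r" if "x \<in> set ts" for x
      using that ts(2) \<open>Max _ < r\<close> Max_ge [of "t ` {1..m}" x] by auto
    then have "{x \<in> set ts. r \<le> x} = {}" by (auto simp: not_le [symmetric])
    then have "alpha m t r = 0" by (simp add: alpha)
    \<comment> \<open>The coefficient is the binomial of s - 1 over s, which vanishes for s at least
      1, while for s = 0 the empty product gives 1.\<close>
    then have zero: "ibinom (int (alpha m t r) + int s - 1) s = 0" if "1 \<le> s" for s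
      using that ibinom_of_nat [of "s - 1" s] by (simp add: of_nat_diff binomial_eq_0)
    have "(\<Sum>s=0..r. of_int (ibinom (int (alpha m t r) + int s - 1) s) * g (labar \<uplus> one_part (r - s))) =
        (\<Sum>s\<in>{0}. of_int (ibinom (int (alpha m t r) + int s - 1) s) * g (labar \<uplus> one_part (r - s)))"
      by (rule sum.mono_neutral_right) (auto simp: zero)
    also have "\<dots> = g (labar \<uplus> one_part r)" by (simp add: ibinom_def)
    also have "\<dots> = g la" unfolding bottom [OF le_refl] by (simp add: la one_r)
    finally show ?thesis using 2 by simp
  qed
  with 1 2 show ?thesis by blast
qed

end
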